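(* Let $g(z)$ be an even entire function of order strictly less than $2$ such that for a certain $\mu\in\mathbb N_0$, $$z^{-2\mu}g(z)=\sum_{n=0}^\infty a_n(-z^2)^n,\qquad a_0\cdot a_n>0\quad\forall n\in\mathbb N,$$ where the $a_n$ are real. Let the nonzero roots of $g$, listed with multiplicity, be $\{\pm z_n : n\in\mathbb N\}$, and suppose that there exists a positive number $M$ such that $$\Re(z_n)>0,\qquad \Re(z_n^2)>1,\qquad |\Im(z_n)|\le M,\qquad\forall n\in\mathbb N .$$ Put $h(z)=z^{-2\mu}g(z)$ and, for $k\in\mathbb N_0$, $$m_k=\sum_{n=1}^\infty\frac1{z_n^{2k+4}}=-\frac{1}{2\,(2k+3)!}\left(\frac{h'(z)}{h(z)}\right)^{(2k+3)}\bigg|_{z=0}.$$ Then all the nonzero roots $\{\pm z_n : n\in\mathbb N\}$ are real if and only if $$(-1)^k\Delta^km_n=\sum_{j=1}^\infty\frac{1}{z_j^{2n+4}}\left(1-\frac1{z_j^2}\right)^k\ge0\qquad\forall n,k\in\mathbb N_0 .$$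
   Context: $\mathbb N=\{1,2,\dots\}$ and $\mathbb N_0=\{0,1,2,\dots\}$. $\Delta$ is the forward difference operator in the index: $\Delta m_n=m_{n+1}-m_n$, so $(-1)^k\Delta^k m_n=\sum_{j=0}^k(-1)^j\binom kj m_{n+j}$. *)

theory Defs
  imports "HOL-Complex_Analysis.Complex_Analysis"
begin

text \<open>The order (of growth) of an entire function,
  \<open>limsup (ln (ln M(r)) / ln r)\<close> as \<open>r \<rightarrow> \<infinity>\<close> with \<open>M(r) = max {|f(w)| : |w| = r}\<close>.
  Since \<open>ln\<close> is total, constant functions (including \<open>0\<close>) get order \<open>0\<close>, as usual.\<close>

definition max_modulus :: "(complex \<Rightarrow> complex) \<Rightarrow> real \<Rightarrow> real" where
  "max_modulus f r = (SUP w\<in>sphere 0 r. norm (f w))"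

definition entire_order :: "(complex \<Rightarrow> complex) \<Rightarrow> ereal" where
  "entire_order f = Limsup at_top (\<lambda>r. ereal (ln (ln (max_modulus f r)) / ln r))"

text \<open>The family \<open>\<zeta>\<close> over the index set \<open>I\<close> lists all nonzero zeros of \<open>f\<close>, each as often as
  its multiplicity. For entire \<open>f\<close>, not identically zero, \<open>zorder f w\<close> is the multiplicity of \<open>w\<close>
  as a zero, and is \<open>0\<close> if \<open>f w \<noteq> 0\<close>; hence the zeros and the members of the family coincide.\<close>

definition lists_nonzero_roots :: "'i set \<Rightarrow> ('i \<Rightarrow> complex) \<Rightarrow> (complex \<Rightarrow> complex) \<Rightarrow> bool" where
  "lists_nonzero_roots I \<zeta> f \<longleftrightarrow>
     (\<forall>i\<in>I. \<zeta> i \<noteq> 0) \<and>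
     (\<forall>w. w \<noteq> 0 \<longrightarrow> finite {i\<in>I. \<zeta> i = w} \<and> int (card {i\<in>I. \<zeta> i = w}) = zorder f w)"

definition fwd_diff :: "(nat \<Rightarrow> 'a::ab_group_add) \<Rightarrow> nat \<Rightarrow> 'a" where
  "fwd_diff m n = m (Suc n) - m n"

end

theory Submission
  imports Defs
begin

text \<open>
  Both the summability of \<open>z\<^sub>n\<^sup>-\<^sup>2\<close> and the formula for \<open>m\<^sub>k\<close> come from dividing the roots of
  modulus less than \<open>R\<close> out of \<open>h\<close>: the quotient has no zeros in the disc of radius \<open>R\<close> and is
  bounded by the maximum of \<open>h\<close> on the circle of radius \<open>2R\<close>, so the Borel-Caratheodory theorem
  makes the Taylor coefficients of its logarithmic derivative vanish as \<open>R\<close> grows, from index 1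
  on because the order is less than 2. No Hadamard factorization is needed.

  For the criterion put \<open>v\<^sub>j = 1 / z\<^sub>j\<^sup>2\<close> and \<open>\<Lambda>(p) = \<Sum>\<^sub>j v\<^sub>j\<^sup>2 p(v\<^sub>j)\<close>. The differences are the values
  \<open>\<Lambda>(x\<^sup>n (1 - x)\<^sup>k)\<close>, so if they are nonnegative, then \<open>\<Lambda>\<close> is nonnegative on the cone generated by
  these polynomials. If some \<open>v\<^sub>i = \<alpha> + i\<beta>\<close> were not real, take \<open>q = 1 - (x - \<alpha>)\<^sup>2\<close>: both \<open>q\<close> and
  \<open>1 + \<epsilon> - q\<close> are in the cone, so \<open>\<Lambda>(p q\<^sup>n)\<close> is \<open>O((1 + \<epsilon>)\<^sup>n)\<close> for every polynomial \<open>p\<close>. But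
  \<open>q(v\<^sub>i) = 1 + \<beta>\<^sup>2\<close>, and \<open>p\<close> can be chosen to vanish at the finitely many other \<open>v\<^sub>j\<close> where \<open>q\<close> is
  large, so \<open>\<Lambda>(p q\<^sup>n)\<close> grows like \<open>(1 + \<beta>\<^sup>2)\<^sup>n\<close>, a contradiction.
\<close>

section \<open>Logarithmic derivatives and zeros\<close>

text \<open>The map \<open>u / (2 * A - u)\<close> sends the half-plane Re u < A into the unit disc
  and fixes 0, so the Schwarz lemma applies to its composition with \<open>f\<close>. On the disc of
  radius \<open>R / 2\<close> it gives |\<phi>| \<le> 1/2, hence |f| \<le> 2A, and Cauchy's
  inequality on that disc finishes.\<close>

lemma borel_caratheodory_higher_deriv:
  fixes f :: "complex \<Rightarrow> complex"
  assumes holf: "f holomorphic_on ball 0 R" and "R > 0" and "f 0 = 0"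
    and Re_less: "\<And>w. w \<in> ball 0 R \<Longrightarrow> Re (f w) < A"
  shows "norm ((deriv ^^ k) f 0) \<le> fact k * (2 * A) / (R / 2) ^ k"
proof (rule Cauchy_inequality)
  have "A > 0"
    using Re_less[of 0] \<open>R > 0\<close> \<open>f 0 = 0\<close> by simp
  have ne: "2 * of_real A - f w \<noteq> 0" if "w \<in> ball 0 R" for w
  proof
    assume "2 * of_real A - f w = 0"
    then have "Re (f w) = 2 * A"
      by (metis eq_iff_diff_eq_0 Re_complex_of_real mult_2 of_real_add)
    with Re_less[OF that] \<open>A > 0\<close> show False by simp
  qed
  define \<phi> where "\<phi> = (\<lambda>w. f (of_real R * w) / (2 * of_real A - f (of_real R * w)))"
  have R_ball: "of_real R * w \<in> ball 0 R" if "norm w < 1" for w :: complex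
    using that \<open>R > 0\<close> by (simp add: norm_mult)
  have hol\<phi>: "\<phi> holomorphic_on ball 0 1"
  proof -
    have "(f \<circ> (\<lambda>w. of_real R * w)) holomorphic_on ball 0 1"
      by (rule holomorphic_on_compose_gen[OF _ holf]) (auto intro!: holomorphic_intros R_ball)
    then show ?thesis
      unfolding \<phi>_def o_def
      by (intro holomorphic_intros) (auto dest!: R_ball ne)
  qed
  have \<phi>_less: "norm (\<phi> w) < 1" if "norm w < 1" for w
  proof -
    let ?u = "f (of_real R * w)"
    have "norm ?u < norm (2 * of_real A - ?u)"
    proof -
      \<comment> \<open>|2A - u|^2 - |u|^2 = 4A(A - Re u), so this inequality is the whole
        claim.\<close>
      have "A * Re ?u < A * A"
        using Re_less[OF R_ball[OF that]] \<open>A > 0\<close> by simp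
      then have "(norm ?u)\<^sup>2 < (norm (2 * of_real A - ?u))\<^sup>2"
        unfolding cmod_power2 by (simp add: power2_eq_square algebra_simps)
      then show ?thesis
        by (simp add: power_less_imp_less_base)
    qed
    then show ?thesis
      using ne[OF R_ball[OF that]] by (simp add: \<phi>_def norm_divide)
  qed
  have bound: "norm (f w) \<le> 2 * A" if "norm w \<le> R / 2" for w
  proof -
    let ?p = "\<phi> (w / of_real R)"
    have n: "norm (w / of_real R) \<le> 1/2"
      using that \<open>R > 0\<close> by (simp add: norm_divide field_simps)
    have "norm ?p \<le> norm (w / of_real R)"
      by (rule Schwarz_Lemma(1)[OF hol\<phi> _ \<phi>_less]) (use n \<open>f 0 = 0\<close> in \<open>auto simp: \<phi>_def\<close>)
    with n have p: "norm ?p \<le> 1/2" by simp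
    have w: "w \<in> ball 0 R"
      using that \<open>R > 0\<close> by simp
    have "?p = f w / (2 * of_real A - f w)"
      using \<open>R > 0\<close> by (simp add: \<phi>_def)
    then have "f w * (1 + ?p) = 2 * of_real A * ?p"
      using ne[OF w] by (simp add: field_simps)
    then have eq: "norm (f w) * norm (1 + ?p) = 2 * A * norm ?p"
      using \<open>A > 0\<close> by (metis norm_mult norm_of_real norm_numeral abs_of_pos)
    have "norm (1 + ?p) \<ge> 1/2"
      using norm_triangle_ineq2[of 1 "- ?p"] p by simp
    then have "norm (f w) * (1/2) \<le> norm (f w) * norm (1 + ?p)"
      by (intro mult_left_mono) auto
    also have "\<dots> \<le> 2 * A * (1/2)"
      unfolding eq using p \<open>A > 0\<close> by (intro mult_left_mono) auto
    finally show ?thesis by simp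
  qed
  show "f holomorphic_on ball 0 (R / 2)"
    by (rule holomorphic_on_subset[OF holf]) (use \<open>R > 0\<close> in auto)
  show "continuous_on (cball 0 (R / 2)) f"
    by (rule holomorphic_on_imp_continuous_on, rule holomorphic_on_subset[OF holf])
       (use \<open>R > 0\<close> in auto)
  show "norm (f w) \<le> 2 * A" if "norm (0 - w) = R / 2" for w
    using bound[of w] that by simp
qed (use \<open>R > 0\<close> in auto)

text \<open>A logarithm \<open>L\<close> of \<open>q\<close> exists on the disc, and
  \<open>f = L - L 0\<close> satisfies Re f = ln |q / q 0| < A. Its derivative is the logarithmic
  derivative of \<open>q\<close>, which shifts the index from \<open>k\<close> to
  \<open>Suc k\<close>.\<close>

lemma higher_logderiv_bound:
  fixes q :: "complex \<Rightarrow> complex"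
  assumes holq: "q holomorphic_on ball 0 R" and "R > 0"
    and nz: "\<And>w. w \<in> ball 0 R \<Longrightarrow> q w \<noteq> 0"
    and less: "\<And>w. w \<in> ball 0 R \<Longrightarrow> norm (q w) < norm (q 0) * exp A"
  shows "norm ((deriv ^^ k) (\<lambda>w. deriv q w / q w) 0) \<le> fact (Suc k) * (2 * A) / (R / 2) ^ Suc k"
proof -
  obtain L where L: "L holomorphic_on ball 0 R" "\<And>w. w \<in> ball 0 R \<Longrightarrow> exp (L w) = q w"
    using holomorphic_logarithm_exists[OF _ _ holq nz, of 0] \<open>R > 0\<close> by auto
  define f where "f = (\<lambda>w. L w - L 0)"
  have holf: "f holomorphic_on ball 0 R"
    unfolding f_def by (intro holomorphic_intros L)
  have Re_less: "Re (f w) < A" if "w \<in> ball 0 R" for w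
  proof -
    have "exp (Re (f w)) = norm (exp (f w))"
      by simp
    also have "\<dots> = norm (q w) / norm (q 0)"
      using L(2)[of 0] L(2)[OF that] \<open>R > 0\<close> by (simp add: f_def exp_diff norm_divide)
    also have "\<dots> < exp A"
      using less[OF that] nz[of 0] \<open>R > 0\<close> by (simp add: field_simps)
    finally show ?thesis by simp
  qed
  have "deriv f w = deriv q w / q w" if w: "w \<in> ball 0 R" for w
  proof -
    have L': "(L has_field_derivative deriv L w) (at w)"
      using holomorphic_derivI[OF L(1) open_ball w] .
    have "((\<lambda>w. exp (L w)) has_field_derivative exp (L w) * deriv L w) (at w)"
      by (rule derivative_eq_intros L' refl)+
    then have "(q has_field_derivative exp (L w) * deriv L w) (at w)"
      by (rule has_field_derivative_transform_within_open[OF _ open_ball w]) (use L in auto)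
    then have "deriv q w = q w * deriv L w"
      using L(2)[OF w] DERIV_imp_deriv by metis
    moreover have "deriv f w = deriv L w"
      unfolding f_def by (rule DERIV_imp_deriv) (rule derivative_eq_intros L' refl | simp)+
    ultimately show ?thesis
      using nz[OF w] by simp
  qed
  then have "eventually (\<lambda>w. deriv q w / q w = deriv f w) (nhds 0)"
    using eventually_nhds_in_open[of "ball 0 R" 0] \<open>R > 0\<close> by (auto elim!: eventually_mono)
  then have "(deriv ^^ k) (\<lambda>w. deriv q w / q w) 0 = (deriv ^^ k) (deriv f) 0"
    by (rule higher_deriv_cong_ev) simp
  also have "\<dots> = (deriv ^^ Suc k) f 0"
    by (simp add: funpow_swap1)
  finally show ?thesis
    using borel_caratheodory_higher_deriv[OF holf \<open>R > 0\<close> _ Re_less, of "Suc k"]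
    by (simp add: f_def)
qed

section \<open>Dividing out finitely many roots\<close>

text \<open>Powers of \<open>c - w\<close> rather than \<open>w - c\<close> keep the sign
  independent of \<open>k\<close>.\<close>

lemma higher_deriv_inverse_linear:
  fixes w c :: complex
  assumes "w \<noteq> c"
  shows "(deriv ^^ k) (\<lambda>w. 1 / (w - c)) w = - fact k / (c - w) ^ Suc k"
  using assms
proof (induction k arbitrary: w)
  case 0
  then show ?case by (simp add: field_simps)
next
  case (Suc k)
  have "eventually (\<lambda>w. (deriv ^^ k) (\<lambda>w. 1 / (w - c)) w = - fact k / (c - w) ^ Suc k) (nhds w)"
    using t1_space_nhds[OF Suc.prems] by eventually_elim (rule Suc.IH)
  then have "deriv ((deriv ^^ k) (\<lambda>w. 1 / (w - c))) w = deriv (\<lambda>w. - fact k / (c - w) ^ Suc k) w"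
    by (rule deriv_cong_ev) simp
  also have "\<dots> = - fact (Suc k) / (c - w) ^ Suc (Suc k)"
    using Suc.prems
    by (intro DERIV_imp_deriv) (auto intro!: derivative_eq_intros simp: divide_simps, cases k, auto simp: algebra_simps)
  finally show ?case by simp
qed

lemma divide_out_root:
  fixes q :: "complex \<Rightarrow> complex"
  assumes holq: "q holomorphic_on UNIV" and "q c = 0" and "c \<noteq> 0"
  obtains p where "p holomorphic_on UNIV" "\<And>w. q w = (1 - w / c) * p w"
proof
  \<comment> \<open>The derivative fills the removable singularity at \<open>c\<close>. The factor
    \<open>- c\<close> normalizes the linear factor to \<open>1 - w / c\<close>, so that the value
    at 0 is unchanged.\<close>
  define p where "p = (\<lambda>w. - c * (if w = c then deriv q c else (q w - q c) / (w - c)))"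
  show "p holomorphic_on UNIV"
    unfolding p_def by (intro holomorphic_on_mult holomorphic_on_const pole_lemma_open[OF holq open_UNIV])
  show "q w = (1 - w / c) * p w" for w
    using assms by (auto simp: p_def field_simps)
qed

lemma eventually_nonzero_entire:
  fixes f :: "complex \<Rightarrow> complex"
  assumes "f holomorphic_on UNIV" and "f b \<noteq> 0"
  shows "eventually (\<lambda>w. f w \<noteq> 0) (at w)"
  using non_zero_neighbour_alt[OF assms(1) open_UNIV connected_UNIV, of w b] assms(2)
  by auto

lemma zorder_linear_factor:
  assumes "c \<noteq> 0"
  shows "zorder (\<lambda>w. 1 - w / c) w = (if w = c then 1 else 0)"
proof (cases "w = c")
  case True
  have "zorder (\<lambda>w. 1 - w / c) c = 1"
    by (rule zorder_eqI[where S = UNIV and g = "\<lambda>_. - 1 / c"]) (use assms in \<open>auto simp: field_simps\<close>)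
  with True show ?thesis by simp
next
  case False
  have "zorder (\<lambda>w. 1 - w / c) w = 0"
    by (rule zorder_eq_0I) (use assms False in \<open>auto intro!: analytic_intros simp: field_simps\<close>)
  with False show ?thesis by simp
qed

text \<open>Logarithmic derivatives turn products into sums, and \<open>1 - w / c\<close>
  contributes \<open>1 / (w - c)\<close>.\<close>

lemma logderiv_linear_factor:
  fixes p q :: "complex \<Rightarrow> complex"
  assumes holp: "p holomorphic_on UNIV" and "p 0 \<noteq> 0" and "c \<noteq> 0"
    and eq: "\<And>w. q w = (1 - w / c) * p w"
  shows "(deriv ^^ k) (\<lambda>w. deriv q w / q w) 0
           = (deriv ^^ k) (\<lambda>w. deriv p w / p w) 0 - fact k / c ^ Suc k"
proof -
  have anap: "p analytic_on {w}" for w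
    using holp analytic_on_holomorphic by blast
  have ev: "eventually (\<lambda>w. w \<noteq> c \<and> p w \<noteq> 0) (nhds 0)"
  proof (rule eventually_conj)
    show "eventually (\<lambda>w. p w \<noteq> 0) (nhds 0)"
      using eventually_nonzero_entire[OF holp \<open>p 0 \<noteq> 0\<close>, of 0] \<open>p 0 \<noteq> 0\<close>
      by (auto simp: eventually_at_filter elim!: eventually_mono)
  qed (use t1_space_nhds \<open>c \<noteq> 0\<close> in metis)
  have "deriv q w / q w = deriv p w / p w + 1 / (w - c)" if "w \<noteq> c" "p w \<noteq> 0" for w
  proof -
    have p': "(p has_field_derivative deriv p w) (at w)"
      using holomorphic_derivI[OF holp] by simp
    have "((\<lambda>w. (1 - w / c) * p w) has_field_derivative (- 1 / c) * p w + (1 - w / c) * deriv p w) (at w)"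
      by (rule derivative_eq_intros p' refl | simp add: \<open>c \<noteq> 0\<close>)+
    then have "deriv q w = (- 1 / c) * p w + (1 - w / c) * deriv p w"
      unfolding eq[abs_def] by (rule DERIV_imp_deriv)
    moreover have "1 - w / c \<noteq> 0"
      using that \<open>c \<noteq> 0\<close> by (simp add: field_simps)
    moreover have "(a * P + u * D) / (u * P) = D / P + a / u" if "u \<noteq> 0" "P \<noteq> 0" for a P u D :: complex
      using that by (simp add: field_simps)
    ultimately have "deriv q w / q w = deriv p w / p w + (- 1 / c) / (1 - w / c)"
      using \<open>p w \<noteq> 0\<close> by (simp only: eq not_False_eq_True)
    also have "(- 1 / c) / (1 - w / c) = 1 / (w - c)"
      using that \<open>c \<noteq> 0\<close> by (simp add: divide_simps)
    finally show ?thesis .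
  qed
  then have "eventually (\<lambda>w. deriv q w / q w = deriv p w / p w + 1 / (w - c)) (nhds 0)"
    using ev by (auto elim!: eventually_mono)
  then have "(deriv ^^ k) (\<lambda>w. deriv q w / q w) 0
               = (deriv ^^ k) (\<lambda>w. deriv p w / p w + 1 / (w - c)) 0"
    by (rule higher_deriv_cong_ev) simp
  also have "\<dots> = (deriv ^^ k) (\<lambda>w. deriv p w / p w) 0 + (deriv ^^ k) (\<lambda>w. 1 / (w - c)) 0"
    by (rule higher_deriv_add_at)
       (use assms in \<open>auto intro!: analytic_intros anap\<close>)
  also have "(deriv ^^ k) (\<lambda>w. 1 / (w - c)) 0 = - fact k / c ^ Suc k"
    using higher_deriv_inverse_linear[of 0 c k] \<open>c \<noteq> 0\<close> by simp
  finally show ?thesis by simp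
qed

text \<open>Induction on \<open>J\<close>, removing one linear factor at a time. The order of the
  quotient at every point is tracked, so that its zero-freeness can later be read off from the
  multiplicities.\<close>

lemma divide_out_roots:
  fixes h :: "complex \<Rightarrow> complex" and \<zeta> :: "'i \<Rightarrow> complex"
  assumes "finite J" and holh: "h holomorphic_on UNIV" and "h 0 \<noteq> 0"
    and nz: "\<And>i. i \<in> J \<Longrightarrow> \<zeta> i \<noteq> 0"
    and le: "\<And>w. int (card {i\<in>J. \<zeta> i = w}) \<le> zorder h w"
  obtains q where "q holomorphic_on UNIV" "\<And>w. h w = (\<Prod>i\<in>J. 1 - w / \<zeta> i) * q w"
    "\<And>w. zorder h w = zorder q w + int (card {i\<in>J. \<zeta> i = w})"
    "\<And>k. (deriv ^^ k) (\<lambda>w. deriv h w / h w) 0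
           = (deriv ^^ k) (\<lambda>w. deriv q w / q w) 0 - fact k * (\<Sum>i\<in>J. 1 / \<zeta> i ^ Suc k)"
proof -
  have "\<exists>q. q holomorphic_on UNIV \<and> (\<forall>w. h w = (\<Prod>i\<in>J. 1 - w / \<zeta> i) * q w) \<and>
     (\<forall>w. zorder h w = zorder q w + int (card {i\<in>J. \<zeta> i = w})) \<and>
     (\<forall>k. (deriv ^^ k) (\<lambda>w. deriv h w / h w) 0
           = (deriv ^^ k) (\<lambda>w. deriv q w / q w) 0 - fact k * (\<Sum>i\<in>J. 1 / \<zeta> i ^ Suc k))"
    using \<open>finite J\<close> nz le
  proof (induction J rule: finite_induct)
    case empty
    then show ?case using holh by auto
  next
    case (insert j J)
    have card: "card {i\<in>insert j J. \<zeta> i = w} = card {i\<in>J. \<zeta> i = w} + (if \<zeta> j = w then 1 else 0)" for w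
    proof -
      have "{i\<in>insert j J. \<zeta> i = w} = (if \<zeta> j = w then insert j {i\<in>J. \<zeta> i = w} else {i\<in>J. \<zeta> i = w})"
        by auto
      then show ?thesis using insert.hyps by simp
    qed
    have "int (card {i\<in>J. \<zeta> i = w}) \<le> zorder h w" for w
      using insert.prems(2)[of w] unfolding card by (simp split: if_splits)
    then obtain q where q: "q holomorphic_on UNIV" "\<And>w. h w = (\<Prod>i\<in>J. 1 - w / \<zeta> i) * q w"
        "\<And>w. zorder h w = zorder q w + int (card {i\<in>J. \<zeta> i = w})"
        "\<And>k. (deriv ^^ k) (\<lambda>w. deriv h w / h w) 0
           = (deriv ^^ k) (\<lambda>w. deriv q w / q w) 0 - fact k * (\<Sum>i\<in>J. 1 / \<zeta> i ^ Suc k)"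
      using insert by auto
    have "q 0 \<noteq> 0"
      using q(2)[of 0] \<open>h 0 \<noteq> 0\<close> by auto
    have anaq: "q analytic_on {w}" for w
      using q(1) analytic_on_holomorphic by blast
    \<comment> \<open>The index \<open>j\<close> is not yet used up: \<open>zorder h\<close> at
      \<open>\<zeta> j\<close> exceeds the number of indices in \<open>J\<close> with this
      value.\<close>
    have "zorder q (\<zeta> j) > 0"
      using insert.prems(2)[of "\<zeta> j"] q(3)[of "\<zeta> j"] unfolding card by simp
    then have "q (\<zeta> j) = 0"
      using zorder_eq_0I[OF anaq] by force
    then obtain p where p: "p holomorphic_on UNIV" "\<And>w. q w = (1 - w / \<zeta> j) * p w"
      using divide_out_root[OF q(1)] insert.prems(1)[of j] by auto
    have "p 0 \<noteq> 0"
      using p(2)[of 0] \<open>q 0 \<noteq> 0\<close> by auto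
    have anap: "p analytic_on {w}" for w
      using p(1) analytic_on_holomorphic by blast
    have zq: "zorder q w = (if \<zeta> j = w then 1 else 0) + zorder p w" for w
    proof -
      have "zorder (\<lambda>w. (1 - w / \<zeta> j) * p w) w = zorder (\<lambda>w. 1 - w / \<zeta> j) w + zorder p w"
        using eventually_nonzero_entire[OF q(1) \<open>q 0 \<noteq> 0\<close>] insert.prems(1)[of j]
        by (intro zorder_times_analytic anap analytic_intros) (auto simp: p(2))
      then show ?thesis
        using zorder_linear_factor[of "\<zeta> j" w] insert.prems(1)[of j] by (auto simp: p(2)[abs_def])
    qed
    show ?case
    proof (intro exI conjI allI)
      show "p holomorphic_on UNIV" by fact
      show "h w = (\<Prod>i\<in>insert j J. 1 - w / \<zeta> i) * p w" for w
        using insert.hyps by (simp add: q(2)[of w] p(2)[of w] mult_ac)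
      show "zorder h w = zorder p w + int (card {i\<in>insert j J. \<zeta> i = w})" for w
        by (subst card) (simp add: q(3) zq)
      show "(deriv ^^ k) (\<lambda>w. deriv h w / h w) 0
              = (deriv ^^ k) (\<lambda>w. deriv p w / p w) 0 - fact k * (\<Sum>i\<in>insert j J. 1 / \<zeta> i ^ Suc k)" for k
        using logderiv_linear_factor[OF p(1) \<open>p 0 \<noteq> 0\<close> _ p(2), of k] insert.prems(1)[of j] insert.hyps
        by (simp add: q(4) algebra_simps)
    qed
  qed
  then show thesis using that by blast
qed

section \<open>Power sums over the nonzero roots\<close>

lemma lists_nonzero_roots_zero_iff:
  assumes holh: "h holomorphic_on UNIV" and "h 0 \<noteq> 0"
    and roots: "lists_nonzero_roots I \<zeta> h" and "w \<noteq> 0"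
  shows "h w = 0 \<longleftrightarrow> (\<exists>i\<in>I. \<zeta> i = w)"
proof -
  have freq: "frequently (\<lambda>w. h w \<noteq> 0) (at w)"
    by (rule eventually_frequently) (use eventually_nonzero_entire[OF holh \<open>h 0 \<noteq> 0\<close>] in auto)
  have "h analytic_on {w}"
    using holh analytic_on_holomorphic by blast
  then have "h w = 0 \<longleftrightarrow> zorder h w \<noteq> 0"
    using zorder_eq_0_iff[OF _ freq] by blast
  also have "\<dots> \<longleftrightarrow> int (card {i\<in>I. \<zeta> i = w}) \<noteq> 0"
    using roots \<open>w \<noteq> 0\<close> by (simp add: lists_nonzero_roots_def)
  also have "\<dots> \<longleftrightarrow> (\<exists>i\<in>I. \<zeta> i = w)"
  proof -
    have "finite {i\<in>I. \<zeta> i = w}"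
      using roots \<open>w \<noteq> 0\<close> by (simp add: lists_nonzero_roots_def)
    then show ?thesis by auto
  qed
  finally show ?thesis .
qed

text \<open>A disc contains finitely many zeros of \<open>h\<close>, and each of them is listed by
  finitely many indices.\<close>

lemma finite_bounded_roots:
  assumes holh: "h holomorphic_on UNIV" and "h 0 \<noteq> 0"
    and roots: "lists_nonzero_roots I \<zeta> h"
  shows "finite {i\<in>I. norm (\<zeta> i) < R}"
proof -
  have "finite {w\<in>cball 0 R. h w = 0}"
  proof (cases "h constant_on UNIV")
    case True
    then show ?thesis
      using \<open>h 0 \<noteq> 0\<close> by (auto simp: constant_on_def)
  qed (use holomorphic_compact_finite_zeros[OF holh open_UNIV connected_UNIV compact_cball subset_UNIV, of 0 R] in simp)
  then have "finite (\<Union>w\<in>{w\<in>cball 0 R. h w = 0}. {i\<in>I. \<zeta> i = w})"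
  proof (rule finite_UN_I)
    fix w assume "w \<in> {w\<in>cball 0 R. h w = 0}"
    with \<open>h 0 \<noteq> 0\<close> have "w \<noteq> 0" by auto
    then show "finite {i\<in>I. \<zeta> i = w}"
      using roots by (simp add: lists_nonzero_roots_def)
  qed
  moreover have "{i\<in>I. norm (\<zeta> i) < R} \<subseteq> (\<Union>w\<in>{w\<in>cball 0 R. h w = 0}. {i\<in>I. \<zeta> i = w})"
  proof
    fix i assume i: "i \<in> {i\<in>I. norm (\<zeta> i) < R}"
    then have "\<zeta> i \<noteq> 0" using roots by (simp add: lists_nonzero_roots_def)
    then have "h (\<zeta> i) = 0"
      using lists_nonzero_roots_zero_iff[OF holh \<open>h 0 \<noteq> 0\<close> roots] i by blast
    with i show "i \<in> (\<Union>w\<in>{w\<in>cball 0 R. h w = 0}. {i\<in>I. \<zeta> i = w})" by auto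
  qed
  ultimately show ?thesis
    by (rule finite_subset[rotated])
qed

text \<open>Let \<open>q\<close> be \<open>h\<close> with the roots of modulus less than
  \<open>R\<close> divided out. It has no zeros in the disc of radius \<open>R\<close>, and the
  quantity to be bounded is a derivative of its logarithmic derivative. For |u| = 2R each removed
  factor has modulus at least 1, because |u / \<zeta>| > 2; so |q| \<le> |h| there, and the maximum
  principle carries the bound inside.\<close>

lemma power_sum_roots_error:
  fixes h :: "complex \<Rightarrow> complex"
  assumes holh: "h holomorphic_on UNIV" and "h 0 \<noteq> 0"
    and roots: "lists_nonzero_roots I \<zeta> h" and "R > 0"
    and bound: "\<And>w. norm w = 2 * R \<Longrightarrow> norm (h w) < norm (h 0) * exp A"
  shows "norm ((deriv ^^ k) (\<lambda>w. deriv h w / h w) 0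
               + fact k * (\<Sum>i | i \<in> I \<and> norm (\<zeta> i) < R. 1 / \<zeta> i ^ Suc k))
           \<le> fact (Suc k) * (2 * A) / (R / 2) ^ Suc k"
proof -
  define J where "J = {i\<in>I. norm (\<zeta> i) < R}"
  have fin: "finite J"
    unfolding J_def by (rule finite_bounded_roots[OF assms(1-3)])
  have nz: "\<zeta> i \<noteq> 0" if "i \<in> J" for i
    using roots that by (auto simp: lists_nonzero_roots_def J_def)
  have anah: "h analytic_on {w}" for w
    using holh analytic_on_holomorphic by blast
  \<comment> \<open>\<open>lists_nonzero_roots\<close> says nothing about the point 0; there the
    order vanishes because \<open>h 0 \<noteq> 0\<close>.\<close>
  have card: "int (card {i\<in>J. \<zeta> i = w}) = (if norm w < R then zorder h w else 0)" for w
  proof (cases "w = 0")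
    case True
    then have "{i\<in>J. \<zeta> i = w} = {}" using nz by auto
    then show ?thesis
      using zorder_eq_0I[OF anah \<open>h 0 \<noteq> 0\<close>] True by (simp only: card.empty) auto
  next
    case False
    have "{i\<in>J. \<zeta> i = w} = (if norm w < R then {i\<in>I. \<zeta> i = w} else {})"
      by (auto simp: J_def)
    then show ?thesis
      using roots False by (auto simp: lists_nonzero_roots_def)
  qed
  have "frequently (\<lambda>w. h w \<noteq> 0) (at w)" for w
    by (rule eventually_frequently) (use eventually_nonzero_entire[OF holh \<open>h 0 \<noteq> 0\<close>] in auto)
  then have le: "int (card {i\<in>J. \<zeta> i = w}) \<le> zorder h w" for w
    using zorder_ge_0[OF anah] by (auto simp: card)
  obtain q where q: "q holomorphic_on UNIV" "\<And>w. h w = (\<Prod>i\<in>J. 1 - w / \<zeta> i) * q w"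
    "\<And>w. zorder h w = zorder q w + int (card {i\<in>J. \<zeta> i = w})"
    "\<And>k. (deriv ^^ k) (\<lambda>w. deriv h w / h w) 0
           = (deriv ^^ k) (\<lambda>w. deriv q w / q w) 0 - fact k * (\<Sum>i\<in>J. 1 / \<zeta> i ^ Suc k)"
    by (rule divide_out_roots[OF fin holh \<open>h 0 \<noteq> 0\<close> nz le]) (assumption, rule that)
  have anaq: "q analytic_on {w}" for w
    using q(1) analytic_on_holomorphic by blast
  have contq: "continuous_on S q" for S
    by (rule holomorphic_on_imp_continuous_on) (rule holomorphic_on_subset[OF q(1) subset_UNIV])
  have q0: "q 0 = h 0"
    using q(2)[of 0] by simp
  have freq: "frequently (\<lambda>w. q w \<noteq> 0) (at w)" for w
    using eventually_nonzero_entire[OF q(1), of 0 w] \<open>h 0 \<noteq> 0\<close>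
    by (intro eventually_frequently) (simp_all add: q0)
  have "q w \<noteq> 0" if "w \<in> ball 0 R" for w
  proof -
    have "zorder q w = 0"
      using q(3)[of w] that unfolding card by simp
    then show ?thesis
      using zorder_eq_0_iff[OF anaq freq] by simp
  qed
  moreover have "norm (q w) < norm (q 0) * exp A" if "w \<in> ball 0 R" for w
  proof -
    have sphere: "norm (q u) \<le> norm (h u)" if "norm u = 2 * R" for u
    proof -
      have "1 \<le> norm (1 - u / \<zeta> i)" if "i \<in> J" for i
      proof -
        have "2 \<le> norm (u / \<zeta> i)"
          using that nz[OF that] \<open>norm u = 2 * R\<close> by (auto simp: J_def norm_divide field_simps)
        then show ?thesis
          using norm_triangle_ineq2[of "u / \<zeta> i" 1] by (simp add: norm_minus_commute)
      qed
      then have "1 \<le> norm (\<Prod>i\<in>J. 1 - u / \<zeta> i)"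
        unfolding prod_norm[symmetric] by (rule prod_ge_1)
      then have "1 * norm (q u) \<le> norm (\<Prod>i\<in>J. 1 - u / \<zeta> i) * norm (q u)"
        by (rule mult_right_mono) simp
      then show ?thesis
        by (simp add: q(2)[of u] norm_mult)
    qed
    obtain u where u: "u \<in> sphere 0 (2 * R)" "\<And>v. v \<in> sphere 0 (2 * R) \<Longrightarrow> norm (q v) \<le> norm (q u)"
      using continuous_attains_sup[OF compact_sphere _ continuous_on_norm[OF contq], of 0 "2 * R"] \<open>R > 0\<close>
      by force
    have "norm (q w) \<le> norm (q u)"
    proof (rule maximum_modulus_frontier[where f = q and S = "cball 0 (2 * R)"])
      show "w \<in> cball 0 (2 * R)" using that \<open>R > 0\<close> by simp
      show "norm (q v) \<le> norm (q u)" if "v \<in> frontier (cball 0 (2 * R))" for v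
        using u(2) that by simp
    qed (use q(1) contq in \<open>auto intro: holomorphic_on_subset\<close>)
    also have "\<dots> < norm (q 0) * exp A"
      using sphere[of u] bound[of u] u(1) by (simp add: q0)
    finally show ?thesis .
  qed
  ultimately have "norm ((deriv ^^ k) (\<lambda>w. deriv q w / q w) 0) \<le> fact (Suc k) * (2 * A) / (R / 2) ^ Suc k"
    using q(1) \<open>R > 0\<close> by (intro higher_logderiv_bound) (auto intro: holomorphic_on_subset)
  then show ?thesis
    by (simp add: q(4) J_def)
qed

text \<open>The error bound with \<open>A = (2 * R) powr \<rho> + c\<close> is of size R^(\<rho> - k
  - 1) plus R^(-k - 1), which tends to 0. The sums are ordered by modulus; absolute convergence is
  not claimed.\<close>

lemma power_sums_roots_tendsto:
  fixes h :: "complex \<Rightarrow> complex"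
  assumes holh: "h holomorphic_on UNIV" and "h 0 \<noteq> 0"
    and roots: "lists_nonzero_roots I \<zeta> h"
    and growth: "eventually (\<lambda>r. \<forall>w. norm w = r \<longrightarrow> norm (h w) \<le> exp (r powr \<rho>)) at_top"
    and "\<rho> < real (Suc k)"
  shows "((\<lambda>R. \<Sum>i | i \<in> I \<and> norm (\<zeta> i) < R. 1 / \<zeta> i ^ Suc k)
            \<longlongrightarrow> - (deriv ^^ k) (\<lambda>w. deriv h w / h w) 0 / fact k) at_top"
proof -
  let ?D = "(deriv ^^ k) (\<lambda>w. deriv h w / h w) 0"
  let ?S = "\<lambda>R. \<Sum>i | i \<in> I \<and> norm (\<zeta> i) < R. 1 / \<zeta> i ^ Suc k"
  \<comment> \<open>Chosen so that \<open>norm (h 0) * exp c = exp 1\<close>; the extra 1 makes the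
    bound strict.\<close>
  define c where "c = 1 - ln (norm (h 0))"
  \<comment> \<open>The error bound in powers of \<open>R / 2\<close>; the factor
    \<open>4 powr \<rho>\<close> comes from 2R = 4(R/2).\<close>
  define B where "B = (\<lambda>R. 2 * fact (Suc k) *
      (4 powr \<rho> * (R / 2) powr (\<rho> - real (Suc k)) + c * (R / 2) powr (- real (Suc k))))"
  have lim: "filterlim (\<lambda>R::real. R / 2) at_top at_top"
    using filterlim_tendsto_pos_mult_at_top[OF tendsto_const[of "1/2"] _ filterlim_ident] by simp
  have "(B \<longlongrightarrow> 2 * fact (Suc k) * (4 powr \<rho> * 0 + c * 0)) at_top"
    unfolding B_def using \<open>\<rho> < real (Suc k)\<close>
    by (intro tendsto_intros tendsto_neg_powr lim) auto
  then have B: "(B \<longlongrightarrow> 0) at_top" by simp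
  have "filterlim (\<lambda>R::real. 2 * R) at_top at_top"
    by (rule filterlim_tendsto_pos_mult_at_top[OF tendsto_const]) (auto simp: filterlim_ident)
  then have "eventually (\<lambda>R. \<forall>w. norm w = 2 * R \<longrightarrow> norm (h w) \<le> exp ((2 * R) powr \<rho>)) at_top"
    by (rule eventually_compose_filterlim[OF growth])
  then have "eventually (\<lambda>R. norm (?D + fact k * ?S R) \<le> B R) at_top"
    using eventually_gt_at_top[of 0]
  proof eventually_elim
    case (elim R)
    have "norm (?D + fact k * ?S R) \<le> fact (Suc k) * (2 * ((2 * R) powr \<rho> + c)) / (R / 2) ^ Suc k"
    proof (rule power_sum_roots_error[OF holh \<open>h 0 \<noteq> 0\<close> roots \<open>R > 0\<close>])
      fix w :: complex assume "norm w = 2 * R"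
      then have "norm (h w) \<le> exp ((2 * R) powr \<rho>)" using elim by simp
      also have "\<dots> < exp ((2 * R) powr \<rho> + 1)" by simp
      also have "\<dots> = norm (h 0) * exp ((2 * R) powr \<rho> + c)"
        using \<open>h 0 \<noteq> 0\<close> by (simp add: c_def exp_add exp_diff)
      finally show "norm (h w) < norm (h 0) * exp ((2 * R) powr \<rho> + c)" .
    qed
    also have "(2 * R) powr \<rho> = 4 powr \<rho> * (R / 2) powr \<rho>"
      using powr_mult[of 4 "R / 2" \<rho>] \<open>R > 0\<close> by simp
    also have "(R / 2) ^ Suc k = (R / 2) powr real (Suc k)"
      using \<open>R > 0\<close> by (subst powr_realpow) auto
    also have "fact (Suc k) * (2 * (4 powr \<rho> * (R / 2) powr \<rho> + c)) / (R / 2) powr real (Suc k) = B R"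
    proof -
      have "f * (2 * (a * x + c)) / y = 2 * f * (a * (x / y) + c * (1 / y))" for f a x y :: real
        by (simp add: divide_inverse algebra_simps)
      then show ?thesis
        unfolding B_def powr_diff powr_minus_divide .
    qed
    finally show ?case .
  qed
  then have "((\<lambda>R. ?D + fact k * ?S R) \<longlongrightarrow> 0) at_top"
    by (rule Lim_null_comparison) (rule B)
  then have "((\<lambda>R. ((?D + fact k * ?S R) - ?D) / fact k) \<longlongrightarrow> (0 - ?D) / fact k) at_top"
    by (intro tendsto_intros) auto
  then show ?thesis by simp
qed

section \<open>Moment functionals on the Bernstein cone\<close>

text \<open>The scalars are nonnegative reals, but the polynomials are typed over the complex
  numbers because they are evaluated at complex nodes and multiplied with complex
  polynomials.\<close>

inductive_set bernstein_cone :: "complex poly set" where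
  basis: "[:0, 1:] ^ n * [:1, - 1:] ^ k \<in> bernstein_cone"
| add: "p \<in> bernstein_cone \<Longrightarrow> q \<in> bernstein_cone \<Longrightarrow> p + q \<in> bernstein_cone"
| scale: "c \<ge> 0 \<Longrightarrow> p \<in> bernstein_cone \<Longrightarrow> smult (complex_of_real c) p \<in> bernstein_cone"

lemma bernstein_cone_1: "1 \<in> bernstein_cone"
  using bernstein_cone.basis[of 0 0] by simp

lemma bernstein_cone_0: "0 \<in> bernstein_cone"
  using bernstein_cone.scale[OF order_refl bernstein_cone_1] by simp

lemma bernstein_cone_sum: "(\<And>i. i \<in> A \<Longrightarrow> f i \<in> bernstein_cone) \<Longrightarrow> sum f A \<in> bernstein_cone"
  by (induction A rule: infinite_finite_induct) (auto intro: bernstein_cone_0 bernstein_cone.add)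

text \<open>Products of generators are generators; the rest is bilinearity.\<close>

lemma bernstein_cone_mult:
  assumes "p \<in> bernstein_cone" and "q \<in> bernstein_cone"
  shows "p * q \<in> bernstein_cone"
  using assms(1)
proof (induction rule: bernstein_cone.induct)
  case (basis n k)
  show ?case using assms(2)
  proof (induction rule: bernstein_cone.induct)
    case (basis n' k')
    show ?case
      using bernstein_cone.basis[of "n + n'" "k + k'"] by (simp only: power_add mult_ac)
  qed (auto simp: distrib_left intro: bernstein_cone.intros)
qed (auto simp: distrib_right intro: bernstein_cone.intros)

lemma bernstein_cone_power: "p \<in> bernstein_cone \<Longrightarrow> p ^ n \<in> bernstein_cone"
  by (induction n) (auto intro: bernstein_cone_1 bernstein_cone_mult)

text \<open>a + bx = (a + b) x + a (1 - x), so the conditions are nonnegativity at the endpoints 0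
  and 1.\<close>

lemma bernstein_cone_linear:
  assumes "a \<ge> 0" "a + b \<ge> 0"
  shows "[:complex_of_real a, complex_of_real b:] \<in> bernstein_cone"
proof -
  have "smult (complex_of_real (a + b)) ([:0, 1:] ^ 1 * [:1, - 1:] ^ 0)
          + smult (complex_of_real a) ([:0, 1:] ^ 0 * [:1, - 1:] ^ 1) \<in> bernstein_cone"
    using assms by (intro bernstein_cone.intros)
  then show ?thesis by simp
qed

text \<open>A nonzero polynomial has finitely many roots. This transfers the identities for real
  Bernstein polynomials to complex ones.\<close>

lemma poly_eqI_of_real:
  fixes p q :: "complex poly"
  assumes "\<And>x::real. poly p (of_real x) = poly q (of_real x)"
  shows "p = q"
proof (rule ccontr)
  assume "p \<noteq> q"
  then have "finite {z. poly (p - q) z = 0}"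
    by (intro poly_roots_finite) simp
  moreover have "range complex_of_real \<subseteq> {z. poly (p - q) z = 0}"
    using assms by auto
  ultimately have "finite (range complex_of_real)"
    by (rule finite_subset[rotated])
  then have "finite (UNIV :: real set)"
    by (rule finite_imageD) (simp add: inj_on_def)
  then show False
    using infinite_UNIV_char_0 by blast
qed

text \<open>With t = k/N the expression equals (t - \<alpha>)^2 + \<epsilon> - t(1 - t)/(N - 1), and
  t(1 - t) \<le> 1/4.\<close>

lemma bernstein_coefficient_nonneg:
  fixes \<alpha> \<epsilon> :: real
  assumes "k \<le> N" and "N \<ge> 2" and "1 / (4 * (real N - 1)) \<le> \<epsilon>"
  shows "0 \<le> real k * (real k - 1) / (real N * (real N - 1)) - 2 * \<alpha> * (real k / real N) + (\<alpha>\<^sup>2 + \<epsilon>)"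
proof -
  define t where "t = real k / real N"
  have N: "real N - 1 > 0" "real N > 0" using \<open>N \<ge> 2\<close> by auto
  have "real k * (real k - 1) / (real N * (real N - 1)) = t * ((t * real N - 1) / (real N - 1))"
    using N by (simp add: t_def)
  also have "\<dots> = t\<^sup>2 - t * (1 - t) / (real N - 1)"
    using N by (simp add: field_simps power2_eq_square)
  finally have eq: "real k * (real k - 1) / (real N * (real N - 1)) = t\<^sup>2 - t * (1 - t) / (real N - 1)" .
  have "t * (1 - t) \<le> 1 / 4"
    using zero_le_power2[of "t - 1 / 2"] by (simp add: power2_eq_square algebra_simps)
  then have "t * (1 - t) / (real N - 1) \<le> (1 / 4) / (real N - 1)"
    using N by (intro divide_right_mono) auto
  also have "\<dots> \<le> \<epsilon>" using assms(3) by simp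
  finally have "t * (1 - t) / (real N - 1) \<le> \<epsilon>" .
  moreover have "0 \<le> (t - \<alpha>)\<^sup>2" by simp
  ultimately show ?thesis
    unfolding eq by (simp add: t_def[symmetric] power2_eq_square algebra_simps)
qed

text \<open>The Bernstein coefficients \<open>c k\<close> of degree \<open>N\<close> come from
  expressing 1, x and x^2 through the sums of B, kB and k(k - 1)B, and they are nonnegative once
  \<open>N\<close> is large. The summand \<epsilon> matters: every nonzero member of the cone is
  positive on (0,1), so for \<alpha> in (0,1) the square alone is not a member.\<close>

lemma bernstein_cone_positive_quadratic:
  fixes \<alpha> \<epsilon> :: real
  assumes "\<epsilon> > 0"
  shows "[:- complex_of_real \<alpha>, 1:]\<^sup>2 + [:complex_of_real \<epsilon>:] \<in> bernstein_cone"
proof -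
  obtain n :: nat where n: "1 / (4 * \<epsilon>) < real n"
    using reals_Archimedean2 by blast
  \<comment> \<open>Adding 2 makes N(N - 1) nonzero and keeps N - 1 above 1/(4\<epsilon>).\<close>
  define N where "N = n + 2"
  have N: "real N > 0" "real N - 1 > 0" and "N \<ge> 2" by (simp_all add: N_def)
  have "1 / (4 * \<epsilon>) \<le> real N - 1" using n by (simp add: N_def)
  then have "1 / (4 * (real N - 1)) \<le> \<epsilon>"
    using N assms by (simp add: field_simps)
  note nonneg = bernstein_coefficient_nonneg[OF _ \<open>N \<ge> 2\<close> this, of _ \<alpha>]
  define c where "c = (\<lambda>k. real k * (real k - 1) / (real N * (real N - 1)) - 2 * \<alpha> * (real k / real N) + (\<alpha>\<^sup>2 + \<epsilon>))"
  define p where "p = (\<Sum>k\<le>N. smult (complex_of_real (real (N choose k) * c k)) ([:0, 1:] ^ k * [:1, - 1:] ^ (N - k)))"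
  have "p \<in> bernstein_cone"
    unfolding p_def
    by (intro bernstein_cone_sum bernstein_cone.scale bernstein_cone.basis mult_nonneg_nonneg)
       (use nonneg in \<open>auto simp: c_def\<close>)
  moreover have "p = [:- complex_of_real \<alpha>, 1:]\<^sup>2 + [:complex_of_real \<epsilon>:]"
  proof (rule poly_eqI_of_real)
    fix x :: real
    have "poly p (of_real x) = of_real (\<Sum>k\<le>N. c k * Bernstein N k x)"
      unfolding p_def poly_sum of_real_sum
      by (intro sum.cong refl) (simp add: Bernstein_def poly_power mult_ac)
    also have "(\<Sum>k\<le>N. c k * Bernstein N k x)
        = (\<Sum>k\<le>N. real k * (real k - 1) * Bernstein N k x) / (real N * (real N - 1))
          - 2 * \<alpha> / real N * (\<Sum>k\<le>N. real k * Bernstein N k x) + (\<alpha>\<^sup>2 + \<epsilon>) * (\<Sum>k\<le>N. Bernstein N k x)"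
      unfolding sum_distrib_left sum_divide_distrib sum_subtractf[symmetric] sum.distrib[symmetric]
      by (intro sum.cong refl) (simp add: c_def algebra_simps)
    also have "\<dots> = (x - \<alpha>)\<^sup>2 + \<epsilon>"
    proof -
      have "real N * (real N - 1) \<noteq> 0" using N by simp
      then have "real N * (real N - 1) * x\<^sup>2 / (real N * (real N - 1)) = x\<^sup>2"
        by (rule nonzero_mult_div_cancel_left)
      then show ?thesis
        unfolding sum_kk_Bernstein sum_k_Bernstein sum_Bernstein
        using N by (simp add: power2_eq_square algebra_simps)
    qed
    finally show "poly p (of_real x) = poly ([:- complex_of_real \<alpha>, 1:]\<^sup>2 + [:complex_of_real \<epsilon>:]) (of_real x)"
      by (simp add: power2_eq_square algebra_simps)
  qed
  ultimately show ?thesis by simp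
qed

text \<open>The analogue in the cone of passing from 0 \<le> q \<le> c to q^n \<le> c^n, by
  telescoping so that each summand is a product of members.\<close>

lemma bernstein_cone_geometric_difference:
  assumes "c \<ge> 0" and "q \<in> bernstein_cone" and "[:complex_of_real c:] - q \<in> bernstein_cone"
  shows "[:complex_of_real c:] ^ n - q ^ n \<in> bernstein_cone"
proof (induction n)
  case 0
  then show ?case by (simp add: bernstein_cone_0)
next
  case (Suc n)
  have "[:complex_of_real c:] ^ Suc n - q ^ Suc n
      = smult (complex_of_real c) ([:complex_of_real c:] ^ n - q ^ n) + q ^ n * ([:complex_of_real c:] - q)"
    by (simp add: algebra_simps smult_diff_right)
  also have "\<dots> \<in> bernstein_cone"
    using Suc assms by (intro bernstein_cone.intros bernstein_cone_mult bernstein_cone_power)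
  finally show ?case .
qed

section \<open>The moment functional: growth of moments and reality of nodes\<close>

lemma poly_bounded_cball:
  fixes p :: "complex poly"
  obtains B where "B \<ge> 0" "\<And>w. norm w \<le> 1 \<Longrightarrow> norm (poly p w) \<le> B"
proof -
  have "compact (poly p ` cball 0 1)"
    by (intro compact_continuous_image continuous_intros compact_cball)
  then obtain B where "\<And>w. norm w \<le> 1 \<Longrightarrow> norm (poly p w) \<le> B"
    using compact_imp_bounded by (fastforce simp: bounded_iff)
  moreover from this[of 0] have "B \<ge> 0"
    by (auto intro: order_trans[OF norm_ge_zero])
  ultimately show thesis using that by blast
qed

lemma summable_moment:
  fixes v :: "nat \<Rightarrow> complex"
  assumes "summable (\<lambda>j. norm (v j) ^ 2)" and "\<And>j. norm (v j) \<le> 1"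
  shows "summable (\<lambda>j. v j ^ 2 * poly p (v j))"
proof -
  obtain B where B: "\<And>w. norm w \<le> 1 \<Longrightarrow> norm (poly p w) \<le> B"
    using poly_bounded_cball by blast
  show ?thesis
  proof (rule summable_comparison_test')
    show "summable (\<lambda>j. norm (v j) ^ 2 * B)"
      using assms(1) by (rule summable_mult2)
    show "norm (v j ^ 2 * poly p (v j)) \<le> norm (v j) ^ 2 * B" for j
      by (simp add: norm_mult norm_power mult_left_mono B assms)
  qed
qed

text \<open>\<open>\<Lambda>\<close> integrates against the complex weights v_j^2 at the nodes v_j.
  The weights give absolute convergence for every polynomial, and \<open>pos\<close> is
  nonnegativity of \<open>\<Lambda>\<close> on the generators of the cone.\<close>

context
  fixes v :: "nat \<Rightarrow> complex" and \<Lambda> :: "complex poly \<Rightarrow> complex"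
  assumes summable: "summable (\<lambda>j. norm (v j) ^ 2)" and le_1: "\<And>j. norm (v j) \<le> 1"
    and pos: "\<And>n k. (\<Sum>j. v j ^ (n + 2) * (1 - v j) ^ k) \<in> \<real>\<^sub>\<ge>\<^sub>0"
  defines "\<Lambda> \<equiv> \<lambda>p. \<Sum>j. v j ^ 2 * poly p (v j)"
begin

lemma moment_add: "\<Lambda> (p + q) = \<Lambda> p + \<Lambda> q"
  unfolding \<Lambda>_def
  by (subst suminf_add[OF summable_moment summable_moment]) (auto simp: summable le_1 algebra_simps)

lemma moment_smult: "\<Lambda> (smult c p) = c * \<Lambda> p"
  unfolding \<Lambda>_def
  by (subst suminf_mult[OF summable_moment, symmetric]) (auto simp: summable le_1 mult_ac)

lemma moment_nonneg: "p \<in> bernstein_cone \<Longrightarrow> \<Lambda> p \<in> \<real>\<^sub>\<ge>\<^sub>0"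
proof (induction rule: bernstein_cone.induct)
  case (basis n k)
  show ?case
    using pos[of n k] by (simp add: \<Lambda>_def poly_power power_add power2_eq_square mult_ac)
qed (auto simp: moment_add moment_smult nonneg_Reals_add_I nonneg_Reals_mult_I)

text \<open>Nonnegativity on the cone makes \<open>\<Lambda>\<close> monotone, so 0 \<le>
  \<open>\<Lambda> (p * q ^ n)\<close> \<le> c^n \<open>\<Lambda> p\<close>.\<close>

lemma moment_bound_cone:
  assumes "c \<ge> 0" and q: "q \<in> bernstein_cone" and "[:complex_of_real c:] - q \<in> bernstein_cone"
    and p: "p \<in> bernstein_cone"
  shows "norm (\<Lambda> (p * q ^ n)) \<le> norm (\<Lambda> p) * c ^ n"
proof -
  have "p * ([:complex_of_real c:] ^ n - q ^ n) \<in> bernstein_cone"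
    using assms by (intro bernstein_cone_mult bernstein_cone_geometric_difference)
  then have 1: "\<Lambda> (p * ([:complex_of_real c:] ^ n - q ^ n)) \<in> \<real>\<^sub>\<ge>\<^sub>0"
    by (rule moment_nonneg)
  have 2: "\<Lambda> (p * q ^ n) \<in> \<real>\<^sub>\<ge>\<^sub>0"
    using p q by (intro moment_nonneg bernstein_cone_mult bernstein_cone_power)
  have "smult (complex_of_real (c ^ n)) p = p * ([:complex_of_real c:] ^ n - q ^ n) + p * q ^ n"
    by (simp add: algebra_simps poly_const_pow)
  then have "of_real (c ^ n) * \<Lambda> p = \<Lambda> (p * ([:complex_of_real c:] ^ n - q ^ n)) + \<Lambda> (p * q ^ n)"
    by (metis moment_add moment_smult)
  moreover have "\<Lambda> p \<in> \<real>\<^sub>\<ge>\<^sub>0"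
    using p by (rule moment_nonneg)
  ultimately show ?thesis
    using 1 2 \<open>c \<ge> 0\<close> by (auto elim!: nonneg_Reals_cases simp flip: of_real_power of_real_mult of_real_add simp: mult.commute)
qed

text \<open>Monomials lie in the cone, and an arbitrary polynomial is a complex combination of
  them.\<close>

lemma moment_bound:
  assumes "c \<ge> 0" and "q \<in> bernstein_cone" and "[:complex_of_real c:] - q \<in> bernstein_cone"
  shows "\<exists>C. \<forall>n. norm (\<Lambda> (p * q ^ n)) \<le> C * c ^ n"
proof -
  \<comment> \<open>The power x^m is carried along because splitting off the constant term of
    \<open>pCons a p\<close> leaves a factor x on the remainder.\<close>
  have "\<exists>C. \<forall>n. norm (\<Lambda> ([:0, 1:] ^ m * p * q ^ n)) \<le> C * c ^ n" for m
  proof (induction p arbitrary: m)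
    case 0
    then show ?case using moment_smult[of 0 0] by (auto intro!: exI[of _ 0])
  next
    case (pCons a p)
    obtain C where C: "\<And>n. norm (\<Lambda> ([:0, 1:] ^ Suc m * p * q ^ n)) \<le> C * c ^ n"
      using pCons.IH by blast
    have X: "[:0, 1:] ^ m \<in> bernstein_cone"
      using bernstein_cone.basis[of m 0] by simp
    have "norm (\<Lambda> ([:0, 1:] ^ m * pCons a p * q ^ n)) \<le> (norm a * norm (\<Lambda> ([:0, 1:] ^ m)) + C) * c ^ n" for n
    proof -
      have "[:0, 1:] ^ m * pCons a p * q ^ n
          = smult a ([:0, 1:] ^ m * q ^ n) + [:0, 1:] ^ Suc m * p * q ^ n"
      proof -
        have "pCons a p = [:a:] + [:0, 1:] * p" by simp
        then show ?thesis by (simp only: power_Suc distrib_left distrib_right mult_ac) (simp add: mult_ac)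
      qed
      then have "norm (\<Lambda> ([:0, 1:] ^ m * pCons a p * q ^ n))
          \<le> norm (a * \<Lambda> ([:0, 1:] ^ m * q ^ n)) + norm (\<Lambda> ([:0, 1:] ^ Suc m * p * q ^ n))"
        by (simp only: moment_add moment_smult norm_triangle_ineq)
      also have "\<dots> \<le> norm a * (norm (\<Lambda> ([:0, 1:] ^ m)) * c ^ n) + C * c ^ n"
        unfolding norm_mult by (intro add_mono mult_left_mono moment_bound_cone assms X C) auto
      finally show ?thesis by (simp add: algebra_simps)
    qed
    then show ?case by blast
  qed
  from this[of 0] show ?thesis by simp
qed

text \<open>The bounds on the real part of \<open>v i\<close> put \<open>q\<close> into the cone,
  and \<open>v i \<noteq> 0\<close> makes the weight of this node nonzero, so that
  \<open>\<Lambda>\<close> detects it.\<close>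

lemma moment_nodes_real:
  assumes "v i \<noteq> 0" and Re: "0 \<le> Re (v i)" "Re (v i) \<le> 1"
  shows "v i \<in> \<real>"
proof (rule ccontr)
  assume "v i \<notin> \<real>"
  define \<alpha> \<beta> where "\<alpha> = Re (v i)" and "\<beta> = Im (v i)"
  have v_eq: "v i = Complex \<alpha> \<beta>" by (simp add: \<alpha>_def \<beta>_def)
  have "\<beta> \<noteq> 0"
    using \<open>v i \<notin> \<real>\<close> by (simp add: \<beta>_def complex_is_Real_iff)
  \<comment> \<open>Strictly between 1 and 1 + \<beta>^2, the value of \<open>q\<close> at
    \<open>v i\<close>.\<close>
  define c where "c = 1 + \<beta>\<^sup>2 / 2"
  define E where "E = [:- complex_of_real \<alpha>, 1:]\<^sup>2"
  define q where "q = 1 - E"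
  have poly_q: "poly q w = 1 - (w - of_real \<alpha>)\<^sup>2" for w
    by (simp add: q_def E_def poly_power)
  \<comment> \<open>1 - (x - \<alpha>)^2 factors as (1 - \<alpha> + x)(1 + \<alpha> - x), and both
    factors are nonnegative at 0 and 1 since 0 \<le> \<alpha> \<le> 1.\<close>
  have "[:complex_of_real (1 - \<alpha>), complex_of_real 1:] * [:complex_of_real (1 + \<alpha>), complex_of_real (- 1):]
          \<in> bernstein_cone"
    using Re by (intro bernstein_cone_mult bernstein_cone_linear) (auto simp: \<alpha>_def)
  also have "[:complex_of_real (1 - \<alpha>), complex_of_real 1:] * [:complex_of_real (1 + \<alpha>), complex_of_real (- 1):] = q"
    by (simp add: q_def E_def power2_eq_square algebra_simps one_pCons)
  finally have q: "q \<in> bernstein_cone" .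
  have "\<beta>\<^sup>2 / 2 > 0" using \<open>\<beta> \<noteq> 0\<close> by simp
  then have "E + [:complex_of_real (\<beta>\<^sup>2 / 2):] \<in> bernstein_cone"
    unfolding E_def by (rule bernstein_cone_positive_quadratic)
  also have "E + [:complex_of_real (\<beta>\<^sup>2 / 2):] = [:complex_of_real c:] - q"
    by (simp add: q_def c_def one_pCons)
  finally have cq: "[:complex_of_real c:] - q \<in> bernstein_cone" .
  have c: "c > 1" using \<open>\<beta> \<noteq> 0\<close> by (simp add: c_def)

  \<comment> \<open>The nodes tend to 0, where |q| \<le> 1 < c; hence only finitely many nodes have
    |q| \<ge> c.\<close>
  have "(\<lambda>j. norm (v j) ^ 2) \<longlonglongrightarrow> 0"
    by (rule summable_LIMSEQ_zero[OF summable])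
  then have "(\<lambda>j. sqrt (norm (v j) ^ 2)) \<longlonglongrightarrow> sqrt 0"
    by (rule tendsto_real_sqrt)
  then have "v \<longlonglongrightarrow> 0"
    by (simp add: tendsto_norm_zero_iff)
  then have "(\<lambda>j. norm (poly q (v j))) \<longlonglongrightarrow> norm (poly q 0)"
    by (intro tendsto_intros)
  moreover have "norm (poly q 0) < c"
  proof -
    have "poly q 0 = of_real (1 - \<alpha>\<^sup>2)" by (simp add: poly_q)
    then have "norm (poly q 0) = 1 - \<alpha>\<^sup>2"
      using Re by (simp only: norm_of_real) (simp add: \<alpha>_def power_le_one)
    also have "\<dots> \<le> 1" by simp
    finally show ?thesis using c by simp
  qed
  ultimately have "eventually (\<lambda>j. norm (poly q (v j)) < c) sequentially"
    by (rule order_tendstoD)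
  then have fin: "finite {j. c \<le> norm (poly q (v j))}"
    unfolding cofinite_eq_sequentially[symmetric] eventually_cofinite by (simp add: not_less)
  have qi: "poly q (v i) = of_real (1 + \<beta>\<^sup>2)"
    by (simp add: poly_q v_eq complex_eq_iff power2_eq_square)
  \<comment> \<open>A node may be repeated, so all indices sharing the value \<open>v i\<close> are
    collected.\<close>
  define J where "J = {j. v j = v i}"
  have "norm (poly q (v i)) \<ge> c"
    unfolding qi norm_of_real using \<open>\<beta>\<^sup>2 / 2 > 0\<close> by (simp add: c_def)
  then have finJ: "finite J"
    by (intro finite_subset[OF _ fin]) (auto simp: J_def)
  have "i \<in> J" by (simp add: J_def)
  \<comment> \<open>\<open>p\<close> removes the finitely many other nodes at which \<open>q\<close> is large, so that no cancellation
    against the node \<open>v i\<close> is possible.\<close>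
  define p where "p = (\<Prod>s\<in>v ` {j. c \<le> norm (poly q (v j))} - {v i}. [:- s, 1:])"
  have pv: "poly p (v i) \<noteq> 0"
    unfolding p_def poly_prod using fin by (auto simp: prod_zero_iff)
  have p0: "poly p (v j) = 0" if "j \<notin> J" "c \<le> norm (poly q (v j))" for j
    unfolding p_def poly_prod using fin that by (auto simp: prod_zero_iff J_def)
  obtain B where "B \<ge> 0" and B: "\<And>w. norm w \<le> 1 \<Longrightarrow> norm (poly p w) \<le> B"
    using poly_bounded_cball by blast
  obtain C where C: "\<And>n. norm (\<Lambda> (p * q ^ n)) \<le> C * c ^ n"
    using moment_bound[OF _ q cq] c by force
  define S where "S = (\<Sum>j. norm (v j) ^ 2)"
  define d where "d = norm (v i ^ 2 * poly p (v i))"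
  have "d > 0" using \<open>v i \<noteq> 0\<close> pv by (simp add: d_def)
  have key: "d * (1 + \<beta>\<^sup>2) ^ n \<le> (C + S * B) * c ^ n" for n
  proof -
    define f where "f = (\<lambda>j. v j ^ 2 * poly (p * q ^ n) (v j))"
    \<comment> \<open>The series without the copies of \<open>v i\<close>: its terms vanish where
      |q| \<ge> c, through \<open>p\<close>, and are O(c^n) elsewhere.\<close>
    define r where "r = (\<lambda>j. if j \<in> J then 0 else f j)"
    have "f sums \<Lambda> (p * q ^ n)"
      unfolding f_def \<Lambda>_def by (rule summable_sums[OF summable_moment[OF summable le_1]])
    moreover have "(\<lambda>j. if j \<in> J then f j else 0) sums sum f J"
      by (rule sums_If_finite_set[OF finJ])
    ultimately have "(\<lambda>j. f j - (if j \<in> J then f j else 0)) sums (\<Lambda> (p * q ^ n) - sum f J)"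
      by (rule sums_diff)
    also have "(\<lambda>j. f j - (if j \<in> J then f j else 0)) = r"
      by (auto simp: r_def)
    finally have r: "r sums (\<Lambda> (p * q ^ n) - sum f J)" .
    have r_le: "norm (r j) \<le> norm (v j) ^ 2 * (B * c ^ n)" for j
    proof (cases "j \<in> J \<or> c \<le> norm (poly q (v j))")
      case True
      then have "r j = 0" using p0 by (auto simp: r_def f_def)
      then show ?thesis using \<open>B \<ge> 0\<close> c by simp
    next
      case False
      then have "norm (poly p (v j)) * norm (poly q (v j)) ^ n \<le> B * c ^ n"
        using \<open>B \<ge> 0\<close> by (intro mult_mono B le_1 power_mono) auto
      then show ?thesis
        using False by (simp add: r_def f_def norm_mult norm_power poly_power mult_left_mono)
    qed
    have "norm (suminf r) \<le> (\<Sum>j. norm (v j) ^ 2 * (B * c ^ n))"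
      by (rule norm_suminf_le[OF r_le summable_mult2[OF summable]])
    also have "\<dots> = S * (B * c ^ n)"
      unfolding S_def by (rule suminf_mult2[OF summable, symmetric])
    finally have rest: "norm (\<Lambda> (p * q ^ n) - sum f J) \<le> S * (B * c ^ n)"
      using sums_unique[OF r] by simp
    \<comment> \<open>All copies contribute the same term, so their sum is \<open>card J\<close>
      times it and nothing cancels.\<close>
    have "sum f J = (\<Sum>j\<in>J. f i)"
      by (rule sum.cong) (auto simp: J_def f_def)
    then have "norm (sum f J) = real (card J) * norm (f i)"
      by (simp add: norm_mult)
    also have "norm (f i) = d * (1 + \<beta>\<^sup>2) ^ n"
    proof -
      have "norm (poly q (v i)) = 1 + \<beta>\<^sup>2"
        unfolding qi norm_of_real by simp
      then show ?thesis
        by (simp add: f_def d_def poly_power norm_mult norm_power mult_ac)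
    qed
    finally have "norm (sum f J) = real (card J) * (d * (1 + \<beta>\<^sup>2) ^ n)" .
    moreover have "1 * (d * (1 + \<beta>\<^sup>2) ^ n) \<le> real (card J) * (d * (1 + \<beta>\<^sup>2) ^ n)"
    proof (rule mult_right_mono)
      have "card J > 0" using finJ \<open>i \<in> J\<close> card_gt_0_iff by blast
      then show "1 \<le> real (card J)" by simp
    qed (use \<open>d > 0\<close> in simp)
    moreover have "norm (sum f J) \<le> norm (\<Lambda> (p * q ^ n)) + norm (\<Lambda> (p * q ^ n) - sum f J)"
      by (metis norm_minus_commute norm_triangle_sub)
    ultimately show ?thesis
      using C[of n] rest by (simp add: algebra_simps)
  qed
  have "(1 + \<beta>\<^sup>2) / c > 1"
  proof -
    have "1 + \<beta>\<^sup>2 > c" using \<open>\<beta>\<^sup>2 / 2 > 0\<close> by (simp add: c_def)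
    then show ?thesis using c by simp
  qed
  then obtain n where "(C + S * B) / d < ((1 + \<beta>\<^sup>2) / c) ^ n"
    using real_arch_pow by blast
  then have "(C + S * B) * c ^ n < d * (1 + \<beta>\<^sup>2) ^ n"
    using c \<open>d > 0\<close> by (simp add: power_divide divide_simps mult_ac)
  with key[of n] show False by simp
qed

end

section \<open>Even entire functions of order less than 2\<close>

text \<open>A fixed exponent strictly between the order and \<open>d\<close> absorbs the limes
  superior.\<close>

lemma entire_order_less_imp_bound:
  assumes "continuous_on UNIV f" and "entire_order f < ereal d"
  obtains \<rho> where "\<rho> < d"
    "eventually (\<lambda>r. \<forall>w. norm w = r \<longrightarrow> norm (f w) \<le> exp (r powr \<rho>)) at_top"
proof -
  obtain \<rho> where \<rho>: "entire_order f < ereal \<rho>" "ereal \<rho> < ereal d"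
    using ereal_dense2[OF assms(2)] by blast
  have "eventually (\<lambda>r. ereal (ln (ln (max_modulus f r)) / ln r) < ereal \<rho>) at_top"
    using \<rho>(1) unfolding entire_order_def by (rule Limsup_lessD)
  then have "eventually (\<lambda>r. \<forall>w. norm w = r \<longrightarrow> norm (f w) \<le> exp (r powr \<rho>)) at_top"
    using eventually_gt_at_top[of 1]
  proof eventually_elim
    case (elim r)
    have max: "max_modulus f r \<le> exp (r powr \<rho>)"
    \<comment> \<open>The iterated logarithm has its usual meaning only in this case; otherwise the
      bound is trivial.\<close>
    proof (cases "max_modulus f r > 1")
      case True
      then have "ln (max_modulus f r) > 0" by simp
      moreover have "ln (ln (max_modulus f r)) < \<rho> * ln r"
        using elim by (simp add: pos_divide_less_eq)
      ultimately have "ln (max_modulus f r) < exp (\<rho> * ln r)"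
        by (metis exp_less_cancel_iff exp_ln)
      also have "\<dots> = r powr \<rho>" using elim by (simp add: powr_def)
      finally have "exp (ln (max_modulus f r)) < exp (r powr \<rho>)" by simp
      then show ?thesis using True by simp
    next
      case False
      then have "max_modulus f r \<le> 1" by simp
      also have "\<dots> \<le> exp (r powr \<rho>)" by simp
      finally show ?thesis .
    qed
    show ?case
    proof (intro allI impI)
      fix w :: complex assume "norm w = r"
      have "compact ((\<lambda>w. norm (f w)) ` sphere 0 r)"
        by (intro compact_continuous_image continuous_intros continuous_on_subset[OF assms(1)]) auto
      then have "bdd_above ((\<lambda>w. norm (f w)) ` sphere 0 r)"
        by (intro bounded_imp_bdd_above compact_imp_bounded)
      then have "norm (f w) \<le> max_modulus f r"
        unfolding max_modulus_def using \<open>norm w = r\<close> by (intro cSUP_upper) auto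
      with max show "norm (f w) \<le> exp (r powr \<rho>)" by simp
    qed
  qed
  with \<rho>(2) that show thesis by simp
qed

text \<open>The derivative is the limit of the difference quotients along the real axis, and the
  reals are closed.\<close>

lemma deriv_real_on_reals:
  fixes f :: "complex \<Rightarrow> complex"
  assumes holf: "f holomorphic_on ball 0 r"
    and real: "\<And>x. \<bar>x\<bar> < r \<Longrightarrow> f (of_real x) \<in> \<real>" and "\<bar>x\<bar> < r"
  shows "deriv f (of_real x) \<in> \<real>"
proof -
  have "of_real x \<in> ball (0::complex) r" using \<open>\<bar>x\<bar> < r\<close> by simp
  then have "((\<lambda>t. (f (of_real x + t) - f (of_real x)) / t) \<longlongrightarrow> deriv f (of_real x)) (at 0)"
    by (intro DERIV_D holomorphic_derivI[OF holf open_ball])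
  moreover have "filterlim complex_of_real (at 0) (at 0)"
    by (rule filterlim_atI) (auto intro!: tendsto_eq_intros simp: eventually_at_filter)
  ultimately have "((\<lambda>t. (f (of_real x + of_real t) - f (of_real x)) / of_real t)
                      \<longlongrightarrow> deriv f (of_real x)) (at (0::real))"
    by (rule filterlim_compose)
  moreover have "eventually (\<lambda>t. (f (of_real x + of_real t) - f (of_real x)) / of_real t \<in> \<real>) (at (0::real))"
  proof -
    have "((\<lambda>t. \<bar>x + t\<bar>) \<longlongrightarrow> \<bar>x + 0\<bar>) (at (0::real))"
      by (intro tendsto_intros)
    then have "eventually (\<lambda>t. \<bar>x + t\<bar> < r) (at (0::real))"
      using \<open>\<bar>x\<bar> < r\<close> by (intro order_tendstoD) auto
    then show ?thesis
    proof eventually_elim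
      case (elim t)
      then show ?case
        using real[OF elim] real[OF \<open>\<bar>x\<bar> < r\<close>] by (auto intro!: Reals_divide Reals_diff)
    qed
  qed
  ultimately show ?thesis
    by (intro Lim_in_closed_set[OF closed_complex_Reals]) auto
qed

lemma higher_deriv_real_on_reals:
  fixes f :: "complex \<Rightarrow> complex"
  assumes holf: "f holomorphic_on ball 0 r"
    and real: "\<And>x. \<bar>x\<bar> < r \<Longrightarrow> f (of_real x) \<in> \<real>" and "\<bar>x\<bar> < r"
  shows "(deriv ^^ k) f (of_real x) \<in> \<real>"
  using \<open>\<bar>x\<bar> < r\<close>
proof (induction k arbitrary: x)
  case (Suc k)
  then show ?case
    using deriv_real_on_reals[OF holomorphic_higher_deriv[OF holf open_ball]] by simp
qed (use real in simp)

lemma sums_Reals: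
  fixes f :: "nat \<Rightarrow> complex"
  assumes "f sums s" and "\<And>n. f n \<in> \<real>"
  shows "s \<in> \<real>"
  using assms by (intro Lim_in_closed_set[OF closed_complex_Reals, of "\<lambda>n. sum f {..<n}"])
    (auto simp: sums_def intro!: always_eventually sum_in_Reals)

lemma sums_nonneg_Reals:
  fixes f :: "nat \<Rightarrow> complex"
  assumes "f sums s" and "\<And>n. f n \<in> \<real>\<^sub>\<ge>\<^sub>0"
  shows "s \<in> \<real>\<^sub>\<ge>\<^sub>0"
proof (rule Lim_in_closed_set[OF closed_nonneg_Reals_complex])
  show "(\<lambda>n. sum f {..<n}) \<longlonglongrightarrow> s"
    using assms(1) by (simp add: sums_def)
  have "sum f A \<in> \<real>\<^sub>\<ge>\<^sub>0" for A
    by (induction A rule: infinite_finite_induct) (auto intro: nonneg_Reals_add_I assms(2))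
  then show "eventually (\<lambda>n. sum f {..<n} \<in> \<real>\<^sub>\<ge>\<^sub>0) sequentially"
    by simp
qed simp

section \<open>Convergence of sums over the roots\<close>

text \<open>Absolute convergence allows rearrangement: the finite sets of indices with |z_n| < R
  exhaust the naturals, so ordering by modulus and by index give the same sum.\<close>

lemma sum_norm_less_tendsto_suminf:
  fixes f z :: "nat \<Rightarrow> complex"
  assumes "summable (\<lambda>n. norm (f n))" and fin: "\<And>R. finite {n. norm (z n) < R}"
  shows "((\<lambda>R. \<Sum>n | norm (z n) < R. f n) \<longlongrightarrow> suminf f) at_top"
proof -
  have "(f has_sum suminf f) UNIV"
    by (rule norm_summable_imp_has_sum[OF assms(1) summable_sums[OF summable_norm_cancel[OF assms(1)]]])
  then have "(sum f \<longlongrightarrow> suminf f) (finite_subsets_at_top UNIV)"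
    by (simp add: has_sum_def)
  moreover have "filterlim (\<lambda>R. {n. norm (z n) < R}) (finite_subsets_at_top UNIV) at_top"
    unfolding filterlim_finite_subsets_at_top
  proof (intro allI impI)
    fix X :: "nat set" assume "finite X \<and> X \<subseteq> UNIV"
    then have "eventually (\<lambda>R. \<forall>n\<in>X. norm (z n) < R) at_top"
      by (intro eventually_ball_finite) (auto intro: eventually_gt_at_top)
    then show "eventually (\<lambda>R. finite {n. norm (z n) < R} \<and> X \<subseteq> {n. norm (z n) < R}
                 \<and> {n. norm (z n) < R} \<subseteq> UNIV) at_top"
      using fin by (auto elim!: eventually_mono)
  qed
  ultimately show ?thesis
    by (rule filterlim_compose)
qed

text \<open>The terms lie in a sector around the positive axis. Their real parts are nonnegative and
  control the norms, so each partial sum of norms is at most \<open>c\<close> times the real part of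
  a large enough sum by modulus, which stays near \<open>Re L\<close>.\<close>

lemma summable_if_sums_norm_less_tendsto:
  fixes f :: "nat \<Rightarrow> complex" and z :: "nat \<Rightarrow> complex"
  assumes lim: "((\<lambda>R. \<Sum>n | norm (z n) < R. f n) \<longlongrightarrow> L) at_top"
    and fin: "\<And>R. finite {n. norm (z n) < R}"
    and le: "\<And>n. norm (f n) \<le> c * Re (f n)" and "c > 0"
  shows "summable (\<lambda>n. norm (f n))"
proof (rule summableI_nonneg_bounded)
  have Re: "Re (f n) \<ge> 0" for n
    using order_trans[OF norm_ge_zero le[of n]] \<open>c > 0\<close> by (simp add: zero_le_mult_iff)
  have "((\<lambda>R. Re (\<Sum>n | norm (z n) < R. f n)) \<longlongrightarrow> Re L) at_top"
    by (intro tendsto_intros lim)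
  then have ev: "eventually (\<lambda>R. Re (\<Sum>n | norm (z n) < R. f n) < Re L + 1) at_top"
    by (rule order_tendstoD) simp
  show "(\<Sum>i<N. norm (f i)) \<le> c * (Re L + 1)" for N
  proof -
    have "eventually (\<lambda>R. \<forall>n\<in>{..<N}. norm (z n) < R) at_top"
      by (intro eventually_ball_finite) (auto intro: eventually_gt_at_top)
    with ev have "eventually (\<lambda>R. Re (\<Sum>n | norm (z n) < R. f n) < Re L + 1
                    \<and> (\<forall>n\<in>{..<N}. norm (z n) < R)) at_top"
      by (rule eventually_conj)
    then obtain R where R: "Re (\<Sum>n | norm (z n) < R. f n) < Re L + 1" "\<forall>n\<in>{..<N}. norm (z n) < R"
      using eventually_happens[of _ at_top] by force
    have "(\<Sum>i<N. norm (f i)) \<le> (\<Sum>i<N. c * Re (f i))"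
      by (intro sum_mono le)
    also have "\<dots> \<le> (\<Sum>n | norm (z n) < R. c * Re (f n))"
      using R(2) fin \<open>c > 0\<close> Re by (intro sum_mono2) auto
    also have "\<dots> = c * Re (\<Sum>n | norm (z n) < R. f n)"
      by (simp add: sum_distrib_left)
    also have "\<dots> \<le> c * (Re L + 1)"
      using R(1) \<open>c > 0\<close> by (intro mult_left_mono) auto
    finally show ?thesis .
  qed
qed simp

text \<open>|z^2| = Re(z^2) + 2(Im z)^2 \<le> (1 + 2M^2) Re(z^2), and inversion preserves the ratio
  of real part to modulus. This is where the strip condition enters.\<close>

lemma norm_inverse_square_le_Re:
  fixes z :: complex
  assumes "Re (z\<^sup>2) > 1" and "\<bar>Im z\<bar> \<le> M"
  shows "norm (1 / z\<^sup>2) \<le> (1 + 2 * M\<^sup>2) * Re (1 / z\<^sup>2)"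
proof -
  have "(Im z)\<^sup>2 \<le> M\<^sup>2"
    using assms(2) abs_le_square_iff[of "Im z" M] by auto
  have "z \<noteq> 0" using assms(1) by auto
  have "norm (z\<^sup>2) = Re (z\<^sup>2) + 2 * (Im z)\<^sup>2"
    by (simp only: norm_power cmod_power2) (simp add: power2_eq_square)
  also have "\<dots> \<le> Re (z\<^sup>2) + 2 * M\<^sup>2 * Re (z\<^sup>2)"
    using mult_mono[of "2 * (Im z)\<^sup>2" "2 * M\<^sup>2" 1 "Re (z\<^sup>2)"] assms(1) \<open>(Im z)\<^sup>2 \<le> M\<^sup>2\<close> by simp
  finally have "norm (z\<^sup>2) / (norm (z\<^sup>2))\<^sup>2 \<le> (1 + 2 * M\<^sup>2) * Re (z\<^sup>2) / (norm (z\<^sup>2))\<^sup>2"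
    by (intro divide_right_mono) (auto simp: algebra_simps)
  moreover have "norm (1 / z\<^sup>2) = norm (z\<^sup>2) / (norm (z\<^sup>2))\<^sup>2"
    using \<open>z \<noteq> 0\<close> by (simp add: norm_divide power2_eq_square)
  moreover have "Re (1 / z\<^sup>2) = Re (z\<^sup>2) / (norm (z\<^sup>2))\<^sup>2"
    by (simp only: Re_divide cmod_power2) simp
  ultimately show ?thesis by simp
qed

text \<open>One more difference multiplies each term by 1 - v_j, because x^n - x^(n+1) = x^n (1 -
  x).\<close>

lemma fwd_diff_sums:
  fixes v :: "nat \<Rightarrow> complex"
  assumes "\<And>n. (\<lambda>j. v j ^ (n + 2)) sums m n"
  shows "(\<lambda>j. v j ^ (n + 2) * (1 - v j) ^ k) sums ((- 1) ^ k * (fwd_diff ^^ k) m n)"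
proof (induction k arbitrary: n)
  case (Suc k)
  have "(\<lambda>j. v j ^ (n + 2) * (1 - v j) ^ k - v j ^ (Suc n + 2) * (1 - v j) ^ k)
          sums ((- 1) ^ k * (fwd_diff ^^ k) m n - (- 1) ^ k * (fwd_diff ^^ k) m (Suc n))"
    by (rule sums_diff[OF Suc.IH Suc.IH])
  also have "(\<lambda>j. v j ^ (n + 2) * (1 - v j) ^ k - v j ^ (Suc n + 2) * (1 - v j) ^ k)
               = (\<lambda>j. v j ^ (n + 2) * (1 - v j) ^ Suc k)"
    by (simp add: algebra_simps)
  also have "(- 1) ^ k * (fwd_diff ^^ k) m n - (- 1) ^ k * (fwd_diff ^^ k) m (Suc n)
               = (- 1) ^ Suc k * (fwd_diff ^^ Suc k) m n"
    by (simp add: fwd_diff_def algebra_simps)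
  finally show ?case .
qed (use assms in simp)

section \<open>Even functions with symmetric roots\<close>

text \<open>In the variable u = w^2 the series is an ordinary power series converging everywhere, so
  its sum \<open>G\<close> is entire and \<open>G (w ^ 2)\<close> extends \<open>F\<close> over
  0.\<close>

lemma even_power_series_remove_sings:
  fixes F :: "complex \<Rightarrow> complex" and a :: "nat \<Rightarrow> complex"
  assumes series: "\<And>w. w \<noteq> 0 \<Longrightarrow> (\<lambda>n. a n * (- (w ^ 2)) ^ n) sums F w"
  shows "remove_sings F holomorphic_on UNIV"
    and "\<And>w. w \<noteq> 0 \<Longrightarrow> remove_sings F w = F w"
    and "remove_sings F 0 = a 0"
proof -
  \<comment> \<open>\<open>csqrt\<close> only selects some w with w^2 = u; holomorphy of
    \<open>G\<close> comes from the power series, so the branch cut does no harm.\<close>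
  define G where "G = (\<lambda>u. if u = 0 then a 0 else F (csqrt u))"
  have G_sums: "(\<lambda>n. a n * (- 1) ^ n * (u - 0) ^ n) sums G u" for u
  proof (cases "u = 0")
    case True
    then show ?thesis
      using powser_sums_zero[of "\<lambda>n. a n * (- 1) ^ n"] by (simp add: G_def)
  next
    case False
    have "(\<lambda>n. a n * (- u) ^ n) sums F (csqrt u)"
      using series[of "csqrt u"] False by simp
    then show ?thesis
      using False by (simp add: G_def power_minus[of u] mult_ac)
  qed
  have "G holomorphic_on UNIV"
    unfolding holomorphic_on_def
  proof
    fix u :: complex
    have "G holomorphic_on ball 0 (norm u + 1)"
      by (rule power_series_holomorphic[OF G_sums])
    then show "G field_differentiable at u within UNIV"
      using holomorphic_on_imp_differentiable_at[of G "ball 0 (norm u + 1)" u] by simp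
  qed
  then have "(G \<circ> (\<lambda>w. w ^ 2)) holomorphic_on UNIV"
    by (intro holomorphic_on_compose_gen[of _ UNIV G UNIV] holomorphic_intros) auto
  then have hol: "(\<lambda>w. G (w ^ 2)) holomorphic_on UNIV"
    by (simp add: o_def)
  have eq: "F w = G (w ^ 2)" if "w \<noteq> 0" for w
  proof (rule sums_unique2[OF series[OF that]])
    show "(\<lambda>n. a n * (- (w ^ 2)) ^ n) sums G (w ^ 2)"
      using G_sums[of "w ^ 2"] by (simp add: power_minus[of "w ^ 2"] mult_ac)
  qed
  have rs: "remove_sings F w = G (w ^ 2)" for w
  proof -
    have "eventually (\<lambda>x. x \<noteq> 0) (at w)"
      by (rule eventually_neq_at_within)
    then have "eventually (\<lambda>x. F x = G (x ^ 2)) (at w)"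
      by eventually_elim (rule eq)
    then have "remove_sings F w = remove_sings (\<lambda>w. G (w ^ 2)) w"
      by (rule remove_sings_cong) simp
    also have "\<dots> = G (w ^ 2)"
      using hol analytic_on_holomorphic by (intro remove_sings_at_analytic) blast
    finally show ?thesis .
  qed
  show "remove_sings F holomorphic_on UNIV"
    using hol by (simp add: rs[abs_def])
  show "remove_sings F w = F w" if "w \<noteq> 0" for w
    using that by (simp add: rs eq)
  show "remove_sings F 0 = a 0"
    by (simp add: rs G_def)
qed

text \<open>Away from 0 the power of w is analytic and zero-free, so it does not change
  orders.\<close>

lemma lists_nonzero_roots_cong_unit:
  assumes holg: "g holomorphic_on UNIV" and holh: "h holomorphic_on UNIV" and "h 0 \<noteq> 0"
    and eq: "\<And>w. w \<noteq> 0 \<Longrightarrow> h w = w powi n * g w"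
  shows "lists_nonzero_roots I \<zeta> h \<longleftrightarrow> lists_nonzero_roots I \<zeta> g"
proof -
  have "zorder h w = zorder g w" if "w \<noteq> 0" for w
  proof -
    have ev: "eventually (\<lambda>x. x \<noteq> 0) (nhds w)"
      using t1_space_nhds[OF that] .
    then have "eventually (\<lambda>x. h x = x powi n * g x) (nhds w)"
      by eventually_elim (rule eq)
    then have "zorder h w = zorder (\<lambda>x. x powi n * g x) w"
      by (intro zorder_cong) (auto simp: eventually_at_filter elim: eventually_mono)
    also have "\<dots> = zorder (\<lambda>x. x powi n) w + zorder g w"
    proof (rule zorder_times_analytic)
      show "g analytic_on {w}" using holg analytic_on_holomorphic by blast
      show "(\<lambda>x. x powi n) analytic_on {w}" using that by (auto intro!: analytic_intros)
      have "eventually (\<lambda>x. x \<noteq> 0) (at w)"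
        using ev by (auto simp: eventually_at_filter elim: eventually_mono)
      with eventually_nonzero_entire[OF holh \<open>h 0 \<noteq> 0\<close>, of w]
      show "eventually (\<lambda>x. x powi n * g x \<noteq> 0) (at w)"
        by eventually_elim (simp add: eq)
    qed
    also have "zorder (\<lambda>x. x powi n) w = 0"
      using that by (intro zorder_eq_0I) (auto intro!: analytic_intros)
    finally show ?thesis by simp
  qed
  then show ?thesis
    by (simp add: lists_nonzero_roots_def)
qed

lemma sum_symmetric_roots:
  fixes z :: "nat \<Rightarrow> complex"
  assumes "even k"
  shows "(\<Sum>i | i \<in> UNIV \<times> {1, - 1} \<and> norm ((\<lambda>(n, s). s * z n) i) < R. 1 / ((\<lambda>(n, s). s * z n) i) ^ k)
           = 2 * (\<Sum>n | norm (z n) < R. 1 / z n ^ k)"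
proof -
  have "{i. i \<in> UNIV \<times> {1, - 1} \<and> norm ((\<lambda>(n, s). s * z n) i) < R} = {n. norm (z n) < R} \<times> {1, - 1}"
    by auto
  then have "(\<Sum>i | i \<in> UNIV \<times> {1, - 1} \<and> norm ((\<lambda>(n, s). s * z n) i) < R. 1 / ((\<lambda>(n, s). s * z n) i) ^ k)
      = (\<Sum>(n, s)\<in>{n. norm (z n) < R} \<times> {1, - 1}. 1 / (s * z n) ^ k)"
    by (simp add: case_prod_unfold)
  also have "\<dots> = (\<Sum>n | norm (z n) < R. \<Sum>s\<in>{1, - 1}. 1 / (s * z n) ^ k)"
    by (rule sum.cartesian_product[symmetric])
  also have "\<dots> = (\<Sum>n | norm (z n) < R. 2 * (1 / z n ^ k))"
    using assms by (intro sum.cong refl) simp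
  finally show ?thesis by (simp add: sum_distrib_left)
qed

text \<open>The exponent 2 gives absolute convergence by the sector argument. Since |z_n| \<ge> 1,
  the higher even powers are then dominated, and the limits by modulus become ordinary sums. The
  factor 1/2 accounts for the roots z_n and -z_n contributing equally.\<close>

lemma symmetric_power_sums:
  fixes h :: "complex \<Rightarrow> complex" and z :: "nat \<Rightarrow> complex"
  assumes holh: "h holomorphic_on UNIV" and "h 0 \<noteq> 0"
    and roots: "lists_nonzero_roots (UNIV \<times> {1, - 1}) (\<lambda>(n, s). s * z n) h"
    and growth: "eventually (\<lambda>r. \<forall>w. norm w = r \<longrightarrow> norm (h w) \<le> exp (r powr \<rho>)) at_top" and "\<rho> < 2"
    and Re: "\<And>n. Re (z n ^ 2) > 1" and Im: "\<And>n. \<bar>Im (z n)\<bar> \<le> M"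
  shows "summable (\<lambda>n. norm (1 / z n ^ 2))"
    and "(\<lambda>n. 1 / z n ^ (2 * k + 2)) sums
           (- 1 / (2 * fact (2 * k + 1)) * (deriv ^^ (2 * k + 1)) (\<lambda>w. deriv h w / h w) 0)"
proof -
  have fin: "finite {n. norm (z n) < R}" for R
  proof (rule finite_imageD)
    have "(\<lambda>n. (n, 1)) ` {n. norm (z n) < R} \<subseteq> {i\<in>UNIV \<times> {1, - 1}. norm ((\<lambda>(n, s). s * z n) i) < R}"
      by auto
    then show "finite ((\<lambda>n. (n, 1::complex)) ` {n. norm (z n) < R})"
      using finite_bounded_roots[OF holh \<open>h 0 \<noteq> 0\<close> roots] finite_subset by blast
  qed (simp add: inj_on_def)
  have lim: "((\<lambda>R. \<Sum>n | norm (z n) < R. 1 / z n ^ (2 * k + 2)) \<longlongrightarrow>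
       - 1 / (2 * fact (2 * k + 1)) * (deriv ^^ (2 * k + 1)) (\<lambda>w. deriv h w / h w) 0) at_top" for k
  proof -
    have "((\<lambda>R. (\<Sum>i | i \<in> UNIV \<times> {1, - 1} \<and> norm ((\<lambda>(n, s). s * z n) i) < R.
              1 / ((\<lambda>(n, s). s * z n) i) ^ Suc (2 * k + 1)) / 2) \<longlongrightarrow>
          (- (deriv ^^ (2 * k + 1)) (\<lambda>w. deriv h w / h w) 0 / fact (2 * k + 1)) / 2) at_top"
      using \<open>\<rho> < 2\<close> by (intro tendsto_intros power_sums_roots_tendsto[OF holh \<open>h 0 \<noteq> 0\<close> roots growth]) auto
    then show ?thesis
      by (subst (asm) sum_symmetric_roots) (simp_all del: fact_Suc add: field_simps)
  qed
  show summ: "summable (\<lambda>n. norm (1 / z n ^ 2))"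
  proof (rule summable_if_sums_norm_less_tendsto[where c = "1 + 2 * M\<^sup>2"])
    show "norm (1 / z n ^ 2) \<le> (1 + 2 * M\<^sup>2) * Re (1 / z n ^ 2)" for n
      by (rule norm_inverse_square_le_Re[OF Re Im])
    show "1 + 2 * M\<^sup>2 > 0"
      by (simp add: add_pos_nonneg)
    show "((\<lambda>R. \<Sum>n | norm (z n) < R. 1 / z n ^ 2) \<longlongrightarrow>
        - 1 / (2 * fact (0 + 1)) * (deriv ^^ (0 + 1)) (\<lambda>w. deriv h w / h w) 0) at_top"
      using lim[of 0] unfolding mult_0_right add_0_left .
  qed (rule fin)
  have le: "norm (1 / z n ^ (2 * k + 2)) \<le> norm (1 / z n ^ 2)" for n
  proof -
    have ge: "norm (z n) ^ 2 \<ge> 1"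
      using complex_Re_le_cmod[of "z n ^ 2"] Re[of n] by (simp add: norm_power)
    have "norm (z n) ^ 2 * 1 \<le> norm (z n) ^ 2 * (norm (z n) ^ 2) ^ k"
      by (intro mult_left_mono one_le_power ge zero_le_power2)
    moreover have "0 < norm (z n) ^ 2" using ge by linarith
    ultimately have "1 / (norm (z n) ^ 2 * (norm (z n) ^ 2) ^ k) \<le> 1 / norm (z n) ^ 2"
      by (intro frac_le) auto
    also have "norm (z n) ^ 2 * (norm (z n) ^ 2) ^ k = norm (z n) ^ (2 * k + 2)"
      unfolding power_add power_mult by (rule mult.commute)
    finally show ?thesis
      by (simp only: norm_divide norm_power norm_one)
  qed
  have summ_k: "summable (\<lambda>n. norm (1 / z n ^ (2 * k + 2)))"
    using summ by (rule summable_comparison_test') (use le in simp)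
  have "suminf (\<lambda>n. 1 / z n ^ (2 * k + 2))
      = - 1 / (2 * fact (2 * k + 1)) * (deriv ^^ (2 * k + 1)) (\<lambda>w. deriv h w / h w) 0"
    by (rule tendsto_unique[OF _ sum_norm_less_tendsto_suminf[OF summ_k fin] lim]) simp
  then show "(\<lambda>n. 1 / z n ^ (2 * k + 2)) sums
           (- 1 / (2 * fact (2 * k + 1)) * (deriv ^^ (2 * k + 1)) (\<lambda>w. deriv h w / h w) 0)"
    using summable_sums[OF summable_norm_cancel[OF summ_k]] by simp
qed

section \<open>The reality criterion\<close>

text \<open>The index set \<open>UNIV \<times> {1, - 1}\<close> lists z_n and -z_n as separate
  roots. Membership in \<open>\<real>\<^sub>\<ge>\<^sub>0\<close> expresses that a complex number is
  real and nonnegative.\<close>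

theorem corollary4:
  fixes g h :: "complex \<Rightarrow> complex" and \<mu> :: nat and a :: "nat \<Rightarrow> real"
    and z :: "nat \<Rightarrow> complex" and M :: real and m :: "nat \<Rightarrow> complex"
  assumes "g holomorphic_on UNIV"
    and "\<And>w. g (- w) = g w"
    and "entire_order g < 2"
    and "\<And>w. w \<noteq> 0 \<Longrightarrow>
           (\<lambda>n. complex_of_real (a n) * (- (w ^ 2)) ^ n) sums (w powi (- 2 * int \<mu>) * g w)"
    and "\<And>n. n \<ge> 1 \<Longrightarrow> a 0 * a n > 0"
    and "lists_nonzero_roots (UNIV \<times> {1, - 1}) (\<lambda>(n, s). s * z n) g"
    and "M > 0"
    and "\<And>n. Re (z n) > 0"
    and "\<And>n. Re (z n ^ 2) > 1"
    and "\<And>n. \<bar>Im (z n)\<bar> \<le> M"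
    \<comment> \<open>\<open>remove_sings\<close> only supplies the limit value \<open>h 0 = a 0\<close>\<close>
    and h_def: "h = remove_sings (\<lambda>w. w powi (- 2 * int \<mu>) * g w)"
    \<comment> \<open>\<open>z\<close> is indexed from 0 instead of 1\<close>
    and m_def: "\<And>k. m k = (\<Sum>n. 1 / z n ^ (2 * k + 4))"
  shows "(\<forall>k. (\<lambda>n. 1 / z n ^ (2 * k + 4)) sums m k
            \<and> m k = - 1 / (2 * fact (2 * k + 3))
                      * (deriv ^^ (2 * k + 3)) (\<lambda>w. deriv h w / h w) 0
            \<and> m k \<in> \<real>)
       \<and> (\<forall>n k. (\<lambda>j. 1 / z j ^ (2 * n + 4) * (1 - 1 / z j ^ 2) ^ k)
                  sums ((- 1) ^ k * (fwd_diff ^^ k) m n))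
       \<and> ((\<forall>w. g w = 0 \<and> w \<noteq> 0 \<longrightarrow> w \<in> \<real>)
            \<longleftrightarrow> (\<forall>n k. (- 1) ^ k * (fwd_diff ^^ k) m n \<in> \<real>\<^sub>\<ge>\<^sub>0))"
proof -
  let ?F = "\<lambda>w. w powi (- 2 * int \<mu>) * g w"
  note holg = \<open>g holomorphic_on UNIV\<close>
  note series = assms(4)
  have h0: "h 0 = of_real (a 0)" and holh: "h holomorphic_on UNIV"
    and h_eq: "\<And>w. w \<noteq> 0 \<Longrightarrow> h w = ?F w"
    unfolding h_def using even_power_series_remove_sings[of "\<lambda>n. of_real (a n)" ?F, OF series] by auto
  have "h 0 \<noteq> 0"
    using assms(5)[of 1] by (auto simp: h0)
  have roots: "lists_nonzero_roots (UNIV \<times> {1, - 1}) (\<lambda>(n, s). s * z n) h"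
    using lists_nonzero_roots_cong_unit[OF holg holh \<open>h 0 \<noteq> 0\<close> h_eq] assms(6) by blast
  obtain \<rho> where "\<rho> < 2"
    and g_growth: "eventually (\<lambda>r. \<forall>w. norm w = r \<longrightarrow> norm (g w) \<le> exp (r powr \<rho>)) at_top"
    using entire_order_less_imp_bound[of g 2] assms(3) holomorphic_on_imp_continuous_on[OF holg] by auto
  \<comment> \<open>For |w| \<ge> 1, dividing by w^(2\<mu>) does not increase the modulus, so
    \<open>h\<close> inherits the growth bound of \<open>g\<close>.\<close>
  have "eventually (\<lambda>r. \<forall>w. norm w = r \<longrightarrow> norm (h w) \<le> exp (r powr \<rho>)) at_top"
    using g_growth eventually_ge_at_top[of 1]
  proof eventually_elim
    case (elim r)
    show ?case
    proof (intro allI impI)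
      fix w :: complex assume w: "norm w = r"
      then have "w \<noteq> 0" using elim by auto
      have "norm (h w) = norm (g w) / r ^ (2 * \<mu>)"
        unfolding h_eq[OF \<open>w \<noteq> 0\<close>]
      proof -
        have "w powi (- 2 * int \<mu>) = inverse (w ^ (2 * \<mu>))"
          using power_int_minus[of w "int (2 * \<mu>)"] by (simp only: power_int_of_nat) simp
        then show "norm (w powi (- 2 * int \<mu>) * g w) = norm (g w) / r ^ (2 * \<mu>)"
          by (simp add: norm_mult norm_inverse norm_power w divide_inverse)
      qed
      also have "\<dots> \<le> norm (g w) / 1"
        using elim by (intro divide_left_mono one_le_power) auto
      also have "\<dots> \<le> exp (r powr \<rho>)" using elim w by simp
      finally show "norm (h w) \<le> exp (r powr \<rho>)" .
    qed
  qed
  note sums = symmetric_power_sums[OF holh \<open>h 0 \<noteq> 0\<close> roots this \<open>\<rho> < 2\<close> assms(9,10)]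

  have h_real: "h (of_real x) \<in> \<real>" for x
  proof (cases "x = 0")
    case False
    then show ?thesis
      unfolding h_eq[of "of_real x", simplified, OF False]
      using sums_Reals[OF series[of "of_real x"]] by (simp add: Reals_power)
  qed (simp add: h0)
  have "continuous_on UNIV h"
    by (rule holomorphic_on_imp_continuous_on[OF holh])
  then have "isCont h 0"
    by (simp add: continuous_on_eq_continuous_at)
  \<comment> \<open>A disc around 0 free of zeros of \<open>h\<close>, where the logarithmic
    derivative is holomorphic and real on real points.\<close>
  then obtain r where "r > 0" and r: "\<And>w. dist 0 w < r \<Longrightarrow> h w \<noteq> 0"
    using continuous_at_avoid[of 0 h 0] \<open>h 0 \<noteq> 0\<close> by blast
  have hol: "(\<lambda>w. deriv h w / h w) holomorphic_on ball 0 r"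
    using holh r by (intro holomorphic_intros) (auto intro: holomorphic_on_subset)
  have logderiv_real: "(deriv ^^ k) (\<lambda>w. deriv h w / h w) 0 \<in> \<real>" for k
  proof -
    have "deriv h (of_real x) / h (of_real x) \<in> \<real>" if "\<bar>x\<bar> < r" for x
      using deriv_real_on_reals[OF holomorphic_on_subset[OF holh subset_UNIV] h_real that] h_real
      by (intro Reals_divide)
    from higher_deriv_real_on_reals[OF hol this, of 0 k] \<open>r > 0\<close> show ?thesis by simp
  qed

  \<comment> \<open>The exponent n + 2 on v_j supplies the weight v_j^2 of the moment
    functional.\<close>
  define v where "v = (\<lambda>n. 1 / z n ^ 2)"
  have v_power: "v j ^ (n + 2) = 1 / z j ^ (2 * n + 4)" for j n
  proof -
    have "v j ^ (n + 2) = 1 / z j ^ (2 * (n + 2))"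
      unfolding v_def power_mult power_one_over ..
    then show ?thesis by (simp only: distrib_left) simp
  qed
  have m_sums: "(\<lambda>n. 1 / z n ^ (2 * k + 4)) sums m k"
    and m_eq: "m k = - 1 / (2 * fact (2 * k + 3)) * (deriv ^^ (2 * k + 3)) (\<lambda>w. deriv h w / h w) 0" for k
  proof -
    have s: "(\<lambda>n. 1 / z n ^ (2 * k + 4)) sums
        (- 1 / (2 * fact (2 * k + 3)) * (deriv ^^ (2 * k + 3)) (\<lambda>w. deriv h w / h w) 0)"
      \<comment> \<open>The index is shifted by one: 2(k + 1) + 2 = 2k + 4.\<close>
      using sums(2)[of "k + 1"] by (simp only: distrib_left mult_1_right add.assoc) simp
    from sums_unique[OF this]
    show "m k = - 1 / (2 * fact (2 * k + 3)) * (deriv ^^ (2 * k + 3)) (\<lambda>w. deriv h w / h w) 0"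
      unfolding m_def by simp
    with s show "(\<lambda>n. 1 / z n ^ (2 * k + 4)) sums m k" by simp
  qed
  have m_real: "m k \<in> \<real>" for k
    unfolding m_eq using logderiv_real by (intro Reals_mult Reals_divide) (auto intro: fact_in_Reals simp del: fact_Suc)
  have "(\<lambda>j. v j ^ (n + 2)) sums m n" for n
    using m_sums[of n] by (simp only: v_power)
  then have v_sums: "(\<lambda>j. v j ^ (n + 2) * (1 - v j) ^ k) sums ((- 1) ^ k * (fwd_diff ^^ k) m n)" for n k
    by (rule fwd_diff_sums)
  have diff_sums: "(\<lambda>j. 1 / z j ^ (2 * n + 4) * (1 - 1 / z j ^ 2) ^ k)
                     sums ((- 1) ^ k * (fwd_diff ^^ k) m n)" for n k
    using v_sums[of n k] unfolding v_power unfolding v_def .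

  have root_iff: "g w = 0 \<longleftrightarrow> (\<exists>n. w = z n \<or> w = - z n)" if "w \<noteq> 0" for w
  proof -
    have "g w = 0 \<longleftrightarrow> h w = 0" using that by (simp add: h_eq)
    also have "\<dots> \<longleftrightarrow> (\<exists>n. w = z n \<or> w = - z n)"
      using lists_nonzero_roots_zero_iff[OF holh \<open>h 0 \<noteq> 0\<close> roots that] by auto
    finally show ?thesis .
  qed
  have z_nz: "z n \<noteq> 0" for n using assms(8)[of n] by auto

  have "(\<forall>w. g w = 0 \<and> w \<noteq> 0 \<longrightarrow> w \<in> \<real>)
          \<longleftrightarrow> (\<forall>n k. (- 1) ^ k * (fwd_diff ^^ k) m n \<in> \<real>\<^sub>\<ge>\<^sub>0)"
  proof (intro iffI allI impI)
    fix n k assume real: "\<forall>w. g w = 0 \<and> w \<noteq> 0 \<longrightarrow> w \<in> \<real>"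
    show "(- 1) ^ k * (fwd_diff ^^ k) m n \<in> \<real>\<^sub>\<ge>\<^sub>0"
    proof (rule sums_nonneg_Reals[OF v_sums])
      fix j
      have "z j \<in> \<real>" using real root_iff z_nz by blast
      then obtain x where x: "z j = of_real x" by (elim Reals_cases)
      \<comment> \<open>This puts the real node 1/x^2 into (0,1), so every term of the series is
        nonnegative.\<close>
      have "x\<^sup>2 > 1" using assms(9)[of j] by (simp add: x flip: of_real_power)
      then have "1 / x\<^sup>2 \<le> 1" by (subst divide_le_eq_1) auto
      then have "0 \<le> (1 / x\<^sup>2) ^ (n + 2) * (1 - 1 / x\<^sup>2) ^ k"
        by (intro mult_nonneg_nonneg zero_le_power) auto
      then have "of_real ((1 / x\<^sup>2) ^ (n + 2) * (1 - 1 / x\<^sup>2) ^ k) \<in> (\<real>\<^sub>\<ge>\<^sub>0 :: complex set)"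
        by (simp only: nonneg_Reals_of_real_iff)
      then show "v j ^ (n + 2) * (1 - v j) ^ k \<in> \<real>\<^sub>\<ge>\<^sub>0"
        by (simp only: v_def x of_real_mult of_real_power of_real_divide of_real_diff of_real_1)
    qed
  next
    fix w assume pos: "\<forall>n k. (- 1) ^ k * (fwd_diff ^^ k) m n \<in> \<real>\<^sub>\<ge>\<^sub>0" and w: "g w = 0 \<and> w \<noteq> 0"
    have v_real: "v i \<in> \<real>" for i
    proof (rule moment_nodes_real)
      have norm_le: "norm (v j) \<le> 1" for j
      proof -
        have "1 \<le> norm (z j ^ 2)"
          using complex_Re_le_cmod[of "z j ^ 2"] assms(9)[of j] by linarith
        then have "1 / norm (z j ^ 2) \<le> 1" by (subst divide_le_eq_1) auto
        then show ?thesis by (simp only: v_def norm_divide norm_one)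
      qed
      show "norm (v j) \<le> 1" for j by (rule norm_le)
      have "summable (\<lambda>j. norm (v j))" using sums(1) by (simp add: v_def)
      then show "summable (\<lambda>j. (norm (v j))\<^sup>2)"
        by (rule summable_comparison_test') (simp add: norm_le power2_eq_square mult_left_le)
      show "(\<Sum>j. v j ^ (n + 2) * (1 - v j) ^ k) \<in> \<real>\<^sub>\<ge>\<^sub>0" for n k
        using pos sums_unique[OF v_sums] by metis
      show "v i \<noteq> 0" using z_nz by (simp add: v_def)
      show "0 \<le> Re (v i)"
        using assms(9)[of i] by (simp add: v_def Re_divide)
      show "Re (v i) \<le> 1"
        using complex_Re_le_cmod[of "v i"] norm_le[of i] by simp
    qed
    have "z i \<in> \<real>" for i
    proof -
      have "z i ^ 2 = 1 / v i" by (simp add: v_def)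
      then have "z i ^ 2 \<in> \<real>" using v_real by (simp add: Reals_divide)
      \<comment> \<open>A real square leaves a real or a purely imaginary root, and the positive
        real part excludes the latter.\<close>
      then have "Re (z i) * Im (z i) = 0"
        by (auto simp: complex_is_Real_iff power2_eq_square)
      then show ?thesis
        using assms(8)[of i] by (simp add: complex_is_Real_iff)
    qed
    then show "w \<in> \<real>"
      using w root_iff by (auto intro: Reals_minus)
  qed
  with m_sums m_eq m_real diff_sums show ?thesis by blast
qed

end
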